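(* Let $G$ be a feathered Hausdorff strongly topological gyrogroup which is isomorphic (as a topological gyrogroup) to a subgyrogroup of a separable Hausdorff strongly topological gyrogroup. Then $G$ is separable.
   Context: All topological spaces are assumed to be Hausdorff. A gyrogroup is a set $G$ with a binary operation $\oplus$ such that: (G1) there is a unique $0\in G$ with $0\oplus a=a=a\oplus 0$ for all $a\in G$; (G2) each $x\in G$ has a unique inverse $\ominus x\in G$ with $\ominus x\oplus x=0=x\oplus(\ominus x)$; (G3) for all $x,y\in G$ there is $\mathrm{gyr}[x,y]\in\mathrm{Aut}(G,\oplus)$ (a bijection of $G$ preserving $\oplus$) with $x\oplus(y\oplus z)=(x\oplus y)\oplus\mathrm{gyr}[x,y](z)$ for all $z\in G$; (G4) $\mathrm{gyr}[x\oplus y,y]=\mathrm{gyr}[x,y]$ for all $x,y\in G$. A topological gyrogroup is a gyrogroup $G$ with a topology such that $\oplus:G\times G\to G$ is jointly continuous and $x\mapsto\ominus x$ is continuous. A strongly topological gyrogroup is a topological gyrogroup having a neighborhood base $\mathscr U$ of $0$ such that $\mathrm{gyr}[x,y](U)=U$ for all $U\in\mathscr U$ and all $x,y\in G$. A subgyrogroup of a gyrogroup $X$ is a nonempty $H\subset X$ that is a gyrogroup under the inherited operation and such that the restriction of $\mathrm{gyr}[a,b]$ to $H$ is an automorphism of $H$ for all $a,b\in H$; it carries the subspace topology. An isomorphism of topological gyrogroups is a bijection preserving $\oplus$ that is a homeomorphism. A base for a space $X$ at a set $F\subset X$ is a family $\gamma$ of open sets each containing $F$ such that every open set containing $F$ contains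 a member of $\gamma$; $F$ has countable character in $X$ if there is a countable base for $X$ at $F$. A topological gyrogroup is feathered if it contains a nonempty compact subset of countable character. Separable means having a countable dense subset. *)

theory Defs
  imports "HOL-Analysis.Analysis"
begin

definition gyro_zero :: "'a set \<Rightarrow> ('a \<Rightarrow> 'a \<Rightarrow> 'a) \<Rightarrow> 'a"
  where "gyro_zero G add = (THE z. z \<in> G \<and> (\<forall>a\<in>G. add z a = a \<and> add a z = a))"

definition gyro_inv :: "'a set \<Rightarrow> ('a \<Rightarrow> 'a \<Rightarrow> 'a) \<Rightarrow> 'a \<Rightarrow> 'a"
  where "gyro_inv G add x =
    (THE y. y \<in> G \<and> add y x = gyro_zero G add \<and> add x y = gyro_zero G add)"

definition gyro_automorphism :: "'a set \<Rightarrow> ('a \<Rightarrow> 'a \<Rightarrow> 'a) \<Rightarrow> ('a \<Rightarrow> 'a) \<Rightarrow> bool"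
  where "gyro_automorphism G add f \<longleftrightarrow>
    bij_betw f G G \<and> (\<forall>x\<in>G. \<forall>y\<in>G. f (add x y) = add (f x) (f y))"

text \<open>The gyrations are carried as a parameter. By left cancellation, which follows from
  G1--G3, their values on the carrier are determined by the operation. All conditions are
  relative to the carrier; values elsewhere are irrelevant.\<close>

locale gyrogroup =
  fixes G :: "'a set"
    and add :: "'a \<Rightarrow> 'a \<Rightarrow> 'a"
    and gyr :: "'a \<Rightarrow> 'a \<Rightarrow> 'a \<Rightarrow> 'a"
  assumes add_closed: "x \<in> G \<Longrightarrow> y \<in> G \<Longrightarrow> add x y \<in> G"
    and G1: "\<exists>!z. z \<in> G \<and> (\<forall>a\<in>G. add z a = a \<and> add a z = a)"
    and G2: "x \<in> G \<Longrightarrow>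
      \<exists>!y. y \<in> G \<and> add y x = gyro_zero G add \<and> add x y = gyro_zero G add"
    and G3_automorphism: "x \<in> G \<Longrightarrow> y \<in> G \<Longrightarrow> gyro_automorphism G add (gyr x y)"
    and G3_assoc: "x \<in> G \<Longrightarrow> y \<in> G \<Longrightarrow> z \<in> G \<Longrightarrow>
      add x (add y z) = add (add x y) (gyr x y z)"
    and G4: "x \<in> G \<Longrightarrow> y \<in> G \<Longrightarrow> z \<in> G \<Longrightarrow> gyr (add x y) y z = gyr x y z"

definition subgyrogroup ::
    "'a set \<Rightarrow> 'a set \<Rightarrow> ('a \<Rightarrow> 'a \<Rightarrow> 'a) \<Rightarrow> ('a \<Rightarrow> 'a \<Rightarrow> 'a \<Rightarrow> 'a) \<Rightarrow> bool"
  where "subgyrogroup H X add gyr \<longleftrightarrow>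
    H \<noteq> {} \<and> H \<subseteq> X \<and> (\<exists>gyr'. gyrogroup H add gyr') \<and>
    (\<forall>a\<in>H. \<forall>b\<in>H. gyro_automorphism H add (gyr a b))"

locale topological_gyrogroup =
  gyrogroup "topspace T" add gyr
  for T :: "'a topology"
    and add :: "'a \<Rightarrow> 'a \<Rightarrow> 'a"
    and gyr :: "'a \<Rightarrow> 'a \<Rightarrow> 'a \<Rightarrow> 'a" +
  assumes add_continuous: "continuous_map (prod_topology T T) T (\<lambda>(x, y). add x y)"
    and inv_continuous: "continuous_map T T (gyro_inv (topspace T) add)"

text \<open>The members of a neighbourhood base need not be open.\<close>

definition nbhd_base_at :: "'a topology \<Rightarrow> 'a \<Rightarrow> 'a set set \<Rightarrow> bool"
  where "nbhd_base_at T x \<U> \<longleftrightarrow>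
    (\<forall>U\<in>\<U>. U \<subseteq> topspace T \<and> (\<exists>V. openin T V \<and> x \<in> V \<and> V \<subseteq> U)) \<and>
    (\<forall>W. openin T W \<and> x \<in> W \<longrightarrow> (\<exists>U\<in>\<U>. U \<subseteq> W))"

locale strongly_topological_gyrogroup =
  topological_gyrogroup T add gyr
  for T :: "'a topology"
    and add :: "'a \<Rightarrow> 'a \<Rightarrow> 'a"
    and gyr :: "'a \<Rightarrow> 'a \<Rightarrow> 'a \<Rightarrow> 'a" +
  assumes gyr_invariant_base:
    "\<exists>\<U>. nbhd_base_at T (gyro_zero (topspace T) add) \<U> \<and>
      (\<forall>U\<in>\<U>. \<forall>x\<in>topspace T. \<forall>y\<in>topspace T. gyr x y ` U = U)"

definition topological_gyrogroup_iso ::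
    "'a topology \<Rightarrow> ('a \<Rightarrow> 'a \<Rightarrow> 'a) \<Rightarrow> 'b topology \<Rightarrow> ('b \<Rightarrow> 'b \<Rightarrow> 'b) \<Rightarrow> ('a \<Rightarrow> 'b) \<Rightarrow> bool"
  where "topological_gyrogroup_iso S addS T addT f \<longleftrightarrow>
    homeomorphic_map S T f \<and>
    (\<forall>x\<in>topspace S. \<forall>y\<in>topspace S. f (addS x y) = addT (f x) (f y))"

definition base_at_set :: "'a topology \<Rightarrow> 'a set \<Rightarrow> 'a set set \<Rightarrow> bool"
  where "base_at_set T F \<gamma> \<longleftrightarrow>
    (\<forall>U\<in>\<gamma>. openin T U \<and> F \<subseteq> U) \<and>
    (\<forall>W. openin T W \<and> F \<subseteq> W \<longrightarrow> (\<exists>U\<in>\<gamma>. U \<subseteq> W))"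

definition countable_character :: "'a topology \<Rightarrow> 'a set \<Rightarrow> bool"
  where "countable_character T F \<longleftrightarrow> (\<exists>\<gamma>. countable \<gamma> \<and> base_at_set T F \<gamma>)"

definition feathered :: "'a topology \<Rightarrow> bool"
  where "feathered T \<longleftrightarrow> (\<exists>F. F \<noteq> {} \<and> compactin T F \<and> countable_character T F)"

end

theory Submission
  imports Defs
begin

text \<open>
  Gyration-invariant neighbourhoods \<open>V\<^sub>n\<close> of \<open>0\<close> with \<open>V\<^sub>n\<^sub>+\<^sub>1 \<oplus> V\<^sub>n\<^sub>+\<^sub>1 \<subseteq> V\<^sub>n\<close>, chosen inside a base at the given
  compact set, intersect in a compact subgyrogroup \<open>K\<close> at which the \<open>V\<^sub>n\<close> form a base. Separability of \<open>X\<close>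
  makes \<open>G\<close> \<open>\<omega>\<close>-narrow, so countably many cosets of \<open>K\<close> have dense union, and it remains to see that
  \<open>K\<close> is separable. Since \<open>X\<close> is separable Hausdorff, closures of subsets of a countable dense set give
  \<open>2\<^sup>\<omega>\<close> neighbourhoods of \<open>0\<close> with intersection \<open>{0}\<close>; shrinking each to a subgyrogroup as
  above yields closed invariant \<open>M\<^sub>\<alpha>\<close>, \<open>\<alpha> < 2\<^sup>\<omega>\<close>, with trivial intersection and second
  countable quotients \<open>K/M\<^sub>\<alpha>\<close>.

  Points of \<open>K\<close> are then built by transfinite recursion along the tower of quotients by
  \<open>\<Inter>\<^bsub>\<beta><\<alpha>\<^esub> M\<^sub>\<beta>\<close>: a function \<open>s\<close> prescribes at each step \<open>\<alpha>\<close> a basic open set of \<open>K/M\<^sub>\<alpha>\<close> that the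
  lifted point should meet if it can. Because the bonding maps are open, membership in a nonempty open
  set is forced by finitely many values of \<open>s\<close>, so a countable family of functions \<open>s\<close> that realises
  every finite pattern produces a dense set. No selection theorem and no dyadicity is required.
\<close>

section \<open>Well-orders, chains of closed sets and finite patterns of functions\<close>

lemma strict_well_order_exists:
  "\<exists>r :: 'i rel. wf r \<and> trans r \<and> total r"
proof -
  obtain r :: "'i rel" where r: "Well_order r" "Field r = UNIV"
    using well_ordering[where 'a = 'i] by blast
  have "wf (r - Id)" using r(1) by (simp add: well_order_on_def)
  moreover have "trans (r - Id)"
    using r(1) by (simp add: well_order_on_def linear_order_on_def partial_order_on_def
        preorder_on_def trans_diff_Id)
  moreover have "total (r - Id)"
    using r by (simp add: well_order_on_def linear_order_on_def)
  ultimately show ?thesis by blast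
qed

text \<open>A nonempty finite subfamily of a chain has a least member, so the finite intersection
  property holds. For empty \<open>I\<close> the intersection is \<open>UNIV\<close>.\<close>

lemma compact_space_chain_Inter_nonempty:
  assumes "compact_space Y" "\<And>i. i \<in> I \<Longrightarrow> closedin Y (C i)" "\<And>i. i \<in> I \<Longrightarrow> C i \<noteq> {}"
    and "\<And>i j. i \<in> I \<Longrightarrow> j \<in> I \<Longrightarrow> C i \<subseteq> C j \<or> C j \<subseteq> C i"
  shows "\<Inter>(C ` I) \<noteq> {}"
proof -
  have "\<Inter>\<F> \<noteq> {}" if \<F>: "finite \<F>" "\<F> \<subseteq> C ` I" for \<F>
  proof (cases "\<F> = {}")
    case False
    have "\<exists>D\<in>\<F>. \<forall>D'\<in>\<F>. D \<subseteq> D'"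
      using \<F>(1) False \<F>(2)
    proof (induction rule: finite_ne_induct)
      case (insert D \<F>)
      then obtain D0 where D0: "D0 \<in> \<F>" "\<forall>D'\<in>\<F>. D0 \<subseteq> D'" by auto
      obtain i j where "i \<in> I" "j \<in> I" "D = C i" "D0 = C j" using insert.prems D0(1) by auto
      then have "D \<subseteq> D0 \<or> D0 \<subseteq> D" using assms(4) by simp
      then show ?case
      proof
        assume "D \<subseteq> D0"
        then show ?thesis using D0(2) by (intro bexI[of _ D]) auto
      next
        assume "D0 \<subseteq> D"
        then show ?thesis using D0 by (intro bexI[of _ D0]) auto
      qed
    qed simp
    then obtain D where D: "D \<in> \<F>" "\<forall>D'\<in>\<F>. D \<subseteq> D'" by blast
    then obtain i where "i \<in> I" "D = C i" using \<F>(2) by blast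
    then have "D \<noteq> {}" using assms(3) by simp
    moreover have "D \<subseteq> \<Inter>\<F>" using D(2) by blast
    ultimately show ?thesis by blast
  qed simp
  moreover have "\<forall>D\<in>C ` I. closedin Y D" using assms(2) by blast
  ultimately show ?thesis
    using assms(1) unfolding compact_space_fip by meson
qed

text \<open>Any two distinct sets in \<open>F\<close> differ at some number; a strict bound on
  finitely many such numbers serves as \<open>n\<close>.\<close>

lemma finite_sets_initial_segments:
  fixes F :: "nat set set"
  assumes "finite F"
  shows "\<exists>n. \<forall>A\<in>F. \<forall>A'\<in>F. A \<inter> {..<n} = A' \<inter> {..<n} \<longrightarrow> A = A'"
proof -
  have "\<exists>k. A \<noteq> A' \<longrightarrow> (k \<in> A) \<noteq> (k \<in> A')" for A A' :: "nat set"
    by (metis set_eqI)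
  then obtain k where k: "\<And>A A' :: nat set. A \<noteq> A' \<Longrightarrow> (k A A' \<in> A) \<noteq> (k A A' \<in> A')"
    by metis
  have "finite (case_prod k ` (F \<times> F))" using assms by simp
  then obtain n where n: "\<forall>i\<in>case_prod k ` (F \<times> F). i < n"
    using finite_nat_set_iff_bounded by blast
  show ?thesis
  proof (intro exI[of _ n] ballI impI, rule ccontr)
    fix A A' assume A: "A \<in> F" "A' \<in> F" "A \<inter> {..<n} = A' \<inter> {..<n}" "A \<noteq> A'"
    have "k A A' \<in> case_prod k ` (F \<times> F)" using A(1,2) by (auto intro!: rev_image_eqI[of "(A, A')"])
    then have "k A A' < n" using n by blast
    then have "k A A' \<in> A \<longleftrightarrow> k A A' \<in> A'"
      using A(3) by (metis IntD1 IntI lessThan_iff)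
    then show False using k[OF A(4)] by blast
  qed
qed

text \<open>This is the combinatorial half of the Hewitt--Marczewski--Pondiczery theorem: a function of a
  set \<open>A\<close> may look only at a finite initial segment of \<open>A\<close>, but finitely many sets are told apart
  by such a segment.\<close>

lemma countable_extends_finite_maps:
  "\<exists>S :: (nat set \<Rightarrow> nat) set. countable S \<and>
    (\<forall>F t. finite F \<longrightarrow> (\<exists>s\<in>S. \<forall>A\<in>F. s A = t A))"
proof -
  define code where "code n A = filter (\<lambda>i. i \<in> A) [0..<n]" for n and A :: "nat set"
  \<comment> \<open>A parameter \<open>p\<close> is a length together with a finite association list
    from codes of initial segments to values; there are only countably many of these.\<close>
  define step :: "nat \<times> (nat list \<times> nat) list \<Rightarrow> nat set \<Rightarrow> nat"
    where "step p A = the (map_of (snd p) (code (fst p) A))" for p A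
  have set_code: "set (code n A) = A \<inter> {..<n}" for n A
    by (auto simp: code_def)
  have "\<forall>F t. finite F \<longrightarrow> (\<exists>s\<in>range step. \<forall>A\<in>F. s A = t A)"
  proof (intro allI impI)
    fix F :: "nat set set" and t :: "nat set \<Rightarrow> nat"
    assume F: "finite F"
    obtain n where sep: "\<forall>A\<in>F. \<forall>A'\<in>F. A \<inter> {..<n} = A' \<inter> {..<n} \<longrightarrow> A = A'"
      using finite_sets_initial_segments[OF F] by blast
    have n: "A = A'" if "A \<in> F" "A' \<in> F" "code n A = code n A'" for A A'
      using sep that set_code[of n A] set_code[of n A'] by metis
    obtain xs where xs: "set xs = F" using F finite_list by blast
    define l where "l = map (\<lambda>A. (code n A, t A)) xs"
    have "map_of l (code n A) = Some (t A)" if A: "A \<in> F" for A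
    proof -
      have "code n A \<in> fst ` set l" using A xs by (simp add: l_def image_image)
      then obtain y where y: "map_of l (code n A) = Some y"
        using map_of_eq_None_iff[of l "code n A"] by blast
      then have "(code n A, y) \<in> set l" by (rule map_of_SomeD)
      then obtain A' where A': "A' \<in> F" "code n A = code n A'" "y = t A'"
        using xs by (auto simp: l_def)
      then show ?thesis using y n[OF A A'(1,2)] by simp
    qed
    then have "\<forall>A\<in>F. step (n, l) A = t A" by (simp add: step_def)
    then show "\<exists>s\<in>range step. \<forall>A\<in>F. s A = t A" by (intro bexI[of _ "step (n, l)"]) auto
  qed
  moreover have "countable (range step)" by simp
  ultimately show ?thesis by (intro exI[of _ "range step"] conjI)
qed

subsection \<open>Towers of open equivalence relations\<close>

text \<open>The axioms abstract a compact gyrogroup with its coset relations: quotient maps modulo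
  every \<open>R J\<close> are open and closed, and the \<open>B \<alpha> i\<close>, saturated or
  not, induce a countable base of the quotient by \<open>E \<alpha>\<close>. Restricting
  \<open>R J\<close> to the carrier makes \<open>R {}\<close> the full relation on it.\<close>

locale open_equivalence_system =
  fixes Y :: "'a topology" and E :: "nat set \<Rightarrow> 'a rel" and B :: "nat set \<Rightarrow> nat \<Rightarrow> 'a set"
    and R :: "nat set set \<Rightarrow> 'a rel"
  defines "R J \<equiv> {(x, y). x \<in> topspace Y \<and> y \<in> topspace Y \<and> (\<forall>\<alpha>\<in>J. (x, y) \<in> E \<alpha>)}"
  assumes compact: "compact_space Y" and Hausdorff: "Hausdorff_space Y"
    and equiv_E: "equiv (topspace Y) (E \<alpha>)"
    and openin_saturation: "openin Y U \<Longrightarrow> openin Y (R J `` U)"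
    and closedin_saturation: "closedin Y C \<Longrightarrow> closedin Y (R J `` C)"
    and openin_B: "openin Y (B \<alpha> i)"
    and base_B: "openin Y U \<Longrightarrow> x \<in> topspace Y \<Longrightarrow> E \<alpha> `` {x} \<subseteq> U \<Longrightarrow>
      \<exists>i. x \<in> B \<alpha> i \<and> B \<alpha> i \<subseteq> U"
    and separating: "(\<And>\<alpha>. (x, y) \<in> E \<alpha>) \<Longrightarrow> x = y"
begin

lemma equiv_R: "equiv (topspace Y) (R J)"
proof -
  have E: "refl_on (topspace Y) (E \<alpha>)" "sym (E \<alpha>)" "trans (E \<alpha>)" for \<alpha>
    using equiv_E[of \<alpha>] by (simp_all add: equiv_def)
  show ?thesis
  proof (rule equivI)
    show "refl_on (topspace Y) (R J)"
      using E(1) by (simp add: R_def refl_on_def)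
    show "sym (R J)"
      unfolding R_def sym_def using symD[OF E(2)] by simp
    show "trans (R J)"
      unfolding R_def trans_def using transD[OF E(3)] by auto
    show "R J \<subseteq> topspace Y \<times> topspace Y" by (auto simp: R_def)
  qed
qed

lemma R_refl: "x \<in> topspace Y \<Longrightarrow> (x, x) \<in> R J"
  using equiv_R[of J] by (simp add: equiv_def refl_on_def)

lemma R_sym: "(x, y) \<in> R J \<Longrightarrow> (y, x) \<in> R J"
  using equiv_R[of J] by (meson equiv_def symD)

lemma R_trans: "(x, y) \<in> R J \<Longrightarrow> (y, z) \<in> R J \<Longrightarrow> (x, z) \<in> R J"
  using equiv_R[of J] by (meson equiv_def transD)

lemma R_topspace: "(x, y) \<in> R J \<Longrightarrow> x \<in> topspace Y \<and> y \<in> topspace Y"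
  by (simp add: R_def)

lemma R_mono: "(x, y) \<in> R J \<Longrightarrow> J' \<subseteq> J \<Longrightarrow> (x, y) \<in> R J'"
  by (auto simp: R_def)

lemma R_Image_mono: "J' \<subseteq> J \<Longrightarrow> R J `` A \<subseteq> R J' `` A"
  by (auto simp: R_def)

lemma closedin_class: "x \<in> topspace Y \<Longrightarrow> closedin Y (R J `` {x})"
  by (simp add: closedin_saturation closedin_Hausdorff_singleton Hausdorff)

lemma R_singleton: "R {\<alpha>} = E \<alpha>"
  using equiv_E[of \<alpha>] by (auto simp: R_def equiv_def refl_on_def)

text \<open>The largest saturated subset of \<open>U\<close> is the complement of the saturation of
  \<open>topspace Y - U\<close>, which is closed.\<close>

lemma saturated_open_kernel:
  assumes "openin Y U" "x \<in> topspace Y" "R J `` {x} \<subseteq> U"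
  obtains P where "openin Y P" "x \<in> P" "P \<subseteq> U" "R J `` P \<subseteq> P"
proof
  let ?P = "topspace Y - R J `` (topspace Y - U)"
  show "openin Y ?P"
    using assms(1) by (intro openin_diff openin_topspace closedin_saturation) auto
  show "x \<in> ?P" using assms R_sym by blast
  show "?P \<subseteq> U" using R_refl by blast
  show "R J `` ?P \<subseteq> ?P" using R_trans R_sym R_topspace by blast
qed

text \<open>The classes of \<open>x\<close> under \<open>R J\<close> and \<open>E \<alpha>\<close>
  meet inside \<open>U\<close>, so normality separates the second class from the part of the first
  outside \<open>U\<close>. This yields \<open>i\<close>: a point of \<open>W\<close> moved within
  its \<open>R J\<close>-class into \<open>B \<alpha> i\<close> lands in \<open>U\<close>.\<close>

lemma successor_step:
  assumes "openin Y U" "U \<noteq> {}" "R (insert \<alpha> J) `` U \<subseteq> U"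
  obtains W i where "openin Y W" "W \<noteq> {}" "R J `` W \<subseteq> W"
    "\<And>w. w \<in> W \<Longrightarrow> \<exists>z\<in>B \<alpha> i. (w, z) \<in> R J"
    "\<And>w z. w \<in> W \<Longrightarrow> z \<in> B \<alpha> i \<Longrightarrow> (w, z) \<in> R J \<Longrightarrow> z \<in> U"
proof -
  obtain x where x: "x \<in> U" "x \<in> topspace Y"
    using assms(1,2) openin_subset by blast
  have "closedin Y (R J `` {x} - U)" "closedin Y (R {\<alpha>} `` {x})"
    using closedin_class[OF x(2)] assms(1) by (auto intro: closedin_diff)
  moreover have "disjnt (R J `` {x} - U) (R {\<alpha>} `` {x})"
  proof -
    have "y \<in> U" if "(x, y) \<in> R J" "(x, y) \<in> R {\<alpha>}" for y
    proof -
      have "(x, y) \<in> R (insert \<alpha> J)" using that by (auto simp: R_def)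
      then show ?thesis using assms(3) x by blast
    qed
    then show ?thesis by (auto simp: disjnt_def)
  qed
  moreover have "normal_space Y"
    using compact Hausdorff compact_Hausdorff_or_regular_imp_normal_space by blast
  ultimately obtain O1 O2 where O: "openin Y O1" "openin Y O2" "R J `` {x} - U \<subseteq> O1"
      "R {\<alpha>} `` {x} \<subseteq> O2" "disjnt O1 O2"
    unfolding normal_space_def by meson
  obtain i where i: "x \<in> B \<alpha> i" "B \<alpha> i \<subseteq> O2"
    using base_B[OF O(2) x(2), of \<alpha>] O(4) unfolding R_singleton by blast
  let ?C = "Y closure_of (B \<alpha> i) - U"
  have "O1 \<inter> Y closure_of (B \<alpha> i) = {}"
    using O(1,5) i(2) by (subst openin_Int_closure_of_eq_empty) (auto simp: disjnt_def)
  then have "R J `` {x} \<subseteq> topspace Y - ?C"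
    using O(3) R_topspace by blast
  moreover have "openin Y (topspace Y - ?C)"
    using assms(1) by (intro openin_diff closedin_diff) auto
  ultimately obtain P where P: "openin Y P" "x \<in> P" "P \<subseteq> topspace Y - ?C" "R J `` P \<subseteq> P"
    using saturated_open_kernel x(2) by metis
  let ?W = "R J `` (B \<alpha> i \<inter> P)"
  show ?thesis
  proof
    show "openin Y ?W" by (intro openin_saturation openin_Int openin_B P)
    show "?W \<noteq> {}" using i(1) P(2) R_refl[OF x(2)] by blast
    show "R J `` ?W \<subseteq> ?W" using R_trans by blast
    show "\<exists>z\<in>B \<alpha> i. (w, z) \<in> R J" if "w \<in> ?W" for w using that R_sym by blast
    show "z \<in> U" if "w \<in> ?W" "z \<in> B \<alpha> i" "(w, z) \<in> R J" for w z
    proof -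
      have "z \<in> P" using that P(4) R_trans by blast
      moreover have "z \<in> Y closure_of (B \<alpha> i)"
        using that(2) closure_of_subset[OF openin_subset[OF openin_B]] by blast
      ultimately show ?thesis using P(3) by blast
    qed
  qed
qed

section \<open>Threads along a well-order of the index set\<close>

context
  fixes r :: "nat set rel"
  assumes wf: "wf r" and trans: "trans r" and total: "total r"
begin

definition below where "below \<alpha> = {\<beta>. (\<beta>, \<alpha>) \<in> r}"
abbreviation upto where "upto \<alpha> \<equiv> insert \<alpha> (below \<alpha>)"

lemma mem_below [simp]: "\<beta> \<in> below \<alpha> \<longleftrightarrow> (\<beta>, \<alpha>) \<in> r"
  by (simp add: below_def)

lemma upto_subset_below: "(\<beta>, \<alpha>) \<in> r \<Longrightarrow> upto \<beta> \<subseteq> below \<alpha>"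
  using trans by (auto dest: transD)

lemma upto_linear: "upto \<beta> \<subseteq> upto \<alpha> \<or> upto \<alpha> \<subseteq> upto \<beta>"
proof (cases "\<alpha> = \<beta>")
  case False
  then have "(\<alpha>, \<beta>) \<in> r \<or> (\<beta>, \<alpha>) \<in> r" using total unfolding total_on_def by blast
  then show ?thesis using upto_subset_below[of \<alpha> \<beta>] upto_subset_below[of \<beta> \<alpha>] by blast
qed simp

text \<open>Here \<open>x\<close> is a limit of the values before \<alpha> and \<open>y\<close> is
  the new value. The index \<open>s \<alpha>\<close> names the basic set that \<open>y\<close> must
  enter whenever the class of \<open>x\<close> modulo \<open>R (below \<alpha>)\<close> meets
  it.\<close>

definition thread_step :: "(nat set \<Rightarrow> nat) \<Rightarrow> (nat set \<Rightarrow> 'a) \<Rightarrow> nat set \<Rightarrow> 'a \<Rightarrow> 'a \<Rightarrow> bool"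
  where "thread_step s p \<alpha> x y \<longleftrightarrow>
    (\<forall>\<beta>. (\<beta>, \<alpha>) \<in> r \<longrightarrow> (p \<beta>, x) \<in> R (upto \<beta>)) \<and> (x, y) \<in> R (below \<alpha>) \<and>
    ((\<exists>z\<in>B \<alpha> (s \<alpha>). (x, z) \<in> R (below \<alpha>)) \<longrightarrow> y \<in> B \<alpha> (s \<alpha>))"

definition thread :: "(nat set \<Rightarrow> nat) \<Rightarrow> (nat set \<Rightarrow> 'a) \<Rightarrow> bool"
  where "thread s p \<longleftrightarrow> (\<forall>\<alpha>. \<exists>x. thread_step s p \<alpha> x (p \<alpha>))"

lemma thread_step_topspace:
  assumes "thread_step s p \<alpha> x y"
  shows "x \<in> topspace Y" "y \<in> topspace Y"
proof -
  have "(x, y) \<in> R (below \<alpha>)" using assms unfolding thread_step_def by blast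
  then show "x \<in> topspace Y" "y \<in> topspace Y" by (auto dest: R_topspace)
qed

lemma thread_step_coherent:
  assumes "thread_step s p \<alpha> x y" "(\<beta>, \<alpha>) \<in> r"
  shows "(p \<beta>, y) \<in> R (upto \<beta>)"
proof (rule R_trans)
  show "(p \<beta>, x) \<in> R (upto \<beta>)" using assms unfolding thread_step_def by blast
  have "(x, y) \<in> R (below \<alpha>)" using assms unfolding thread_step_def by blast
  then show "(x, y) \<in> R (upto \<beta>)" using upto_subset_below[OF assms(2)] by (rule R_mono)
qed

text \<open>The classes of the \<open>p \<beta>\<close> are closed and shrink along
  \<open>r\<close>, so compactness gives a common point. It serves at intermediate stages, with
  \<open>J = below \<alpha>\<close>, and at the end, with \<open>J = UNIV\<close>.\<close>

lemma coherent_limit: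
  assumes "topspace Y \<noteq> {}" "\<And>\<alpha>. \<alpha> \<in> J \<Longrightarrow> p \<alpha> \<in> topspace Y"
    and coh: "\<And>\<alpha> \<beta>. \<alpha> \<in> J \<Longrightarrow> \<beta> \<in> J \<Longrightarrow> (\<beta>, \<alpha>) \<in> r \<Longrightarrow> (p \<beta>, p \<alpha>) \<in> R (upto \<beta>)"
  shows "\<exists>x\<in>topspace Y. \<forall>\<beta>\<in>J. (p \<beta>, x) \<in> R (upto \<beta>)"
proof (cases "J = {}")
  case False
  let ?C = "\<lambda>\<beta>. R (upto \<beta>) `` {p \<beta>}"
  have nested: "?C \<alpha> \<subseteq> ?C \<beta>" if "\<alpha> \<in> J" "\<beta> \<in> J" "(\<beta>, \<alpha>) \<in> r" for \<alpha> \<beta>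
  proof -
    have "(p \<beta>, y) \<in> R (upto \<beta>)" if "(p \<alpha>, y) \<in> R (upto \<alpha>)" for y
      using R_trans[OF coh R_mono[OF that]] upto_subset_below \<open>\<alpha> \<in> J\<close> \<open>\<beta> \<in> J\<close> \<open>(\<beta>, \<alpha>) \<in> r\<close> by blast
    then show ?thesis by blast
  qed
  have "\<Inter>(?C ` J) \<noteq> {}"
  proof (rule compact_space_chain_Inter_nonempty[OF compact])
    show "closedin Y (?C i)" if "i \<in> J" for i using closedin_class assms(2) that by blast
    show "?C i \<noteq> {}" if "i \<in> J" for i using R_refl assms(2) that by blast
    show "?C i \<subseteq> ?C j \<or> ?C j \<subseteq> ?C i" if "i \<in> J" "j \<in> J" for i j
      using nested that total unfolding total_on_def by (metis UNIV_I order_refl)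
  qed
  then obtain x where x: "\<forall>\<beta>\<in>J. (p \<beta>, x) \<in> R (upto \<beta>)" by blast
  obtain \<beta> where "\<beta> \<in> J" using False by blast
  then have "x \<in> topspace Y" using x R_topspace[of "p \<beta>" x] by blast
  then show ?thesis using x by (intro bexI[of _ x])
next
  case True
  obtain x where "x \<in> topspace Y" using assms(1) by (metis ex_in_conv)
  then show ?thesis using True by (intro bexI[of _ x]) auto
qed

lemma thread_exists:
  assumes "topspace Y \<noteq> {}"
  shows "\<exists>p. thread s p"
  unfolding thread_def
proof (rule dependent_wf_choice[OF wf])
  \<comment> \<open>The recursion is legitimate because the step at \<alpha> consults
    \<open>p\<close> only strictly below \<alpha>.\<close>
  show "(\<exists>x. thread_step s f \<alpha> x y) = (\<exists>x. thread_step s g \<alpha> x y)"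
    if "\<And>z. (z, \<alpha>) \<in> r \<Longrightarrow> f z = g z" for f g \<alpha> y
    using that by (simp add: thread_step_def)
next
  fix \<alpha> p assume step: "\<And>\<beta>. (\<beta>, \<alpha>) \<in> r \<Longrightarrow> \<exists>x. thread_step s p \<beta> x (p \<beta>)"
  have "\<exists>x\<in>topspace Y. \<forall>\<beta>\<in>below \<alpha>. (p \<beta>, x) \<in> R (upto \<beta>)"
  proof (rule coherent_limit[OF assms])
    show "p \<beta> \<in> topspace Y" if "\<beta> \<in> below \<alpha>" for \<beta>
      using step[of \<beta>] that thread_step_topspace(2)[of s p \<beta>] by auto
    show "(p \<gamma>, p \<beta>) \<in> R (upto \<gamma>)" if "\<beta> \<in> below \<alpha>" "\<gamma> \<in> below \<alpha>" "(\<gamma>, \<beta>) \<in> r" for \<beta> \<gamma>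
      using step[of \<beta>] that thread_step_coherent[of s p \<beta>] by auto
  qed
  then obtain x where x: "x \<in> topspace Y"
      "\<And>\<beta>. (\<beta>, \<alpha>) \<in> r \<Longrightarrow> (p \<beta>, x) \<in> R (upto \<beta>)"
    by auto
  show "\<exists>y x. thread_step s p \<alpha> x y"
  proof (cases "\<exists>z\<in>B \<alpha> (s \<alpha>). (x, z) \<in> R (below \<alpha>)")
    case True
    then obtain z where "z \<in> B \<alpha> (s \<alpha>)" "(x, z) \<in> R (below \<alpha>)" by blast
    then have "thread_step s p \<alpha> x z" using x unfolding thread_step_def by simp
    then show ?thesis by blast
  next
    case False
    then have "thread_step s p \<alpha> x x" using x R_refl[OF x(1)] unfolding thread_step_def by simp
    then show ?thesis by blast
  qed
qed

text \<open>The classes of a point of \<open>W\<close> under \<open>R (upto \<beta>)\<close>, for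
  \<beta> in \<open>J\<close>, form a chain whose intersection lies in its class under
  \<open>R J\<close>, hence in \<open>W\<close>; by compactness a single one of them already lies in
  \<open>W\<close>.\<close>

lemma limit_step:
  assumes "openin Y W" "W \<noteq> {}" "R J `` W \<subseteq> W" "J \<noteq> {}"
  shows "\<exists>\<beta>\<in>J. \<exists>U. openin Y U \<and> U \<noteq> {} \<and> R (upto \<beta>) `` U \<subseteq> U \<and> U \<subseteq> W"
proof -
  obtain x where x: "x \<in> W" "x \<in> topspace Y" using assms(1,2) openin_subset by blast
  have "\<exists>\<beta>\<in>J. R (upto \<beta>) `` {x} \<subseteq> W"
  proof (rule ccontr)
    assume neg: "\<not> ?thesis"
    have "\<Inter>((\<lambda>\<beta>. R (upto \<beta>) `` {x} - W) ` J) \<noteq> {}"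
    proof (rule compact_space_chain_Inter_nonempty[OF compact])
      show "closedin Y (R (upto i) `` {x} - W)" for i
        using closedin_class[OF x(2)] assms(1) by (intro closedin_diff) auto
      show "R (upto i) `` {x} - W \<noteq> {}" if "i \<in> J" for i using neg that by blast
      show "R (upto i) `` {x} - W \<subseteq> R (upto j) `` {x} - W \<or>
        R (upto j) `` {x} - W \<subseteq> R (upto i) `` {x} - W" for i j
        using upto_linear[of i j] R_Image_mono[of "upto i" "upto j" "{x}"]
          R_Image_mono[of "upto j" "upto i" "{x}"] by blast
    qed
    then obtain y where y: "\<And>\<beta>. \<beta> \<in> J \<Longrightarrow> (x, y) \<in> R (upto \<beta>)" "y \<notin> W" using assms(4) by blast
    then have "(x, y) \<in> R J" using assms(4) by (fastforce simp: R_def)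
    then show False using y(2) x assms(3) by blast
  qed
  then obtain \<beta> where \<beta>: "\<beta> \<in> J" "R (upto \<beta>) `` {x} \<subseteq> W" by blast
  then obtain P where "openin Y P" "x \<in> P" "P \<subseteq> W" "R (upto \<beta>) `` P \<subseteq> P"
    using saturated_open_kernel[OF assms(1) x(2)] by metis
  then show ?thesis using \<beta>(1) by blast
qed

text \<open>\<open>successor_step\<close> trades the condition on \<open>p \<alpha>\<close> for the
  value \<open>s \<alpha> = i\<close> and a condition on the limit point before \<alpha>;
  \<open>limit_step\<close> reduces the latter to a condition on a single earlier
  \<open>p \<beta>\<close>. Descent in \<open>r\<close> stops, so only finitely many values get
  fixed.\<close>

lemma finitely_forced:
  assumes "openin Y U" "U \<noteq> {}" "R (upto \<alpha>) `` U \<subseteq> U"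
  shows "\<exists>F t. finite F \<and> F \<subseteq> upto \<alpha> \<and>
    (\<forall>s p. thread s p \<longrightarrow> (\<forall>\<beta>\<in>F. s \<beta> = t \<beta>) \<longrightarrow> p \<alpha> \<in> U)"
  using assms
proof (induction \<alpha> arbitrary: U rule: wf_induct_rule[OF wf])
  case (1 \<alpha>)
  obtain W i where W: "openin Y W" "W \<noteq> {}" "R (below \<alpha>) `` W \<subseteq> W"
      "\<And>w. w \<in> W \<Longrightarrow> \<exists>z\<in>B \<alpha> i. (w, z) \<in> R (below \<alpha>)"
      "\<And>w z. w \<in> W \<Longrightarrow> z \<in> B \<alpha> i \<Longrightarrow> (w, z) \<in> R (below \<alpha>) \<Longrightarrow> z \<in> U"
    using successor_step[OF 1(2-4)] by metis
  have "\<exists>F t. finite F \<and> F \<subseteq> below \<alpha> \<and>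
    (\<forall>s p x. thread s p \<longrightarrow> (\<forall>\<beta>\<in>F. s \<beta> = t \<beta>) \<longrightarrow> thread_step s p \<alpha> x (p \<alpha>) \<longrightarrow> x \<in> W)"
  proof (cases "below \<alpha> = {}")
    \<comment> \<open>At the least index \<open>R {}\<close> is the full relation, so the nonempty
      saturated set \<open>W\<close> is the whole space.\<close>
    case True
    have "x \<in> W" if "thread_step s p \<alpha> x (p \<alpha>)" for s p x
    proof -
      obtain w where w: "w \<in> W" "w \<in> topspace Y" using W(1,2) openin_subset by blast
      have "x \<in> topspace Y" using that by (rule thread_step_topspace)
      then have "(w, x) \<in> R (below \<alpha>)" using w(2) unfolding True by (simp add: R_def)
      then show ?thesis using W(3) w(1) by blast
    qed
    then show ?thesis by (intro exI[of _ "{}"]) auto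
  next
    case False
    then obtain \<beta> V where V: "\<beta> \<in> below \<alpha>" "openin Y V" "V \<noteq> {}" "R (upto \<beta>) `` V \<subseteq> V" "V \<subseteq> W"
      using limit_step[OF W(1-3) False] by blast
    then obtain F t where F: "finite F" "F \<subseteq> upto \<beta>"
        "\<And>s p. thread s p \<Longrightarrow> (\<forall>\<beta>\<in>F. s \<beta> = t \<beta>) \<Longrightarrow> p \<beta> \<in> V"
      using 1(1)[of \<beta> V] by auto
    have "x \<in> W" if "thread s p" "\<forall>\<beta>\<in>F. s \<beta> = t \<beta>" "thread_step s p \<alpha> x (p \<alpha>)" for s p x
    proof -
      have "(p \<beta>, x) \<in> R (upto \<beta>)" using that(3) V(1) unfolding thread_step_def by simp
      then show ?thesis using F(3)[OF that(1,2)] V(4,5) by blast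
    qed
    moreover have "F \<subseteq> below \<alpha>" using F(2) upto_subset_below[of \<beta> \<alpha>] V(1) by auto
    ultimately show ?thesis using F(1) by blast
  qed
  then obtain F t where F: "finite F" "F \<subseteq> below \<alpha>"
      "\<And>s p x. thread s p \<Longrightarrow> (\<forall>\<beta>\<in>F. s \<beta> = t \<beta>) \<Longrightarrow> thread_step s p \<alpha> x (p \<alpha>) \<Longrightarrow> x \<in> W"
    by blast
  \<comment> \<open>Redefining \<open>t\<close> at \<alpha> therefore leaves the earlier
    prescriptions intact.\<close>
  have "\<alpha> \<notin> F" using F(2) wf by (auto dest: wf_not_refl)
  have "p \<alpha> \<in> U" if p: "thread s p" and s: "\<forall>\<beta>\<in>insert \<alpha> F. s \<beta> = (t(\<alpha> := i)) \<beta>" for s p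
  proof -
    obtain x where x: "thread_step s p \<alpha> x (p \<alpha>)" using p unfolding thread_def by blast
    have "\<forall>\<beta>\<in>F. s \<beta> = t \<beta>" using s \<open>\<alpha> \<notin> F\<close> by (metis fun_upd_other insertCI)
    then have "x \<in> W" using F(3) p x by blast
    moreover have "s \<alpha> = i" using s by simp
    ultimately show ?thesis using W(4,5) x unfolding thread_step_def by blast
  qed
  then show ?case using F(1,2) by (intro exI[of _ "insert \<alpha> F"] exI[of _ "t(\<alpha> := i)"]) auto
qed

text \<open>The order may have no last element, so each thread is completed to a limit point
  \<open>q s\<close>. Those with \<open>s\<close> in the countable family \<open>S\<close> are
  dense, since membership in an open set is forced by finitely many values of
  \<open>s\<close>.\<close>

lemma separable_if_well_ordered: "separable_space Y"
proof (cases "topspace Y = {}")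
  case True
  then show ?thesis by (auto simp: separable_space_def)
next
  case False
  obtain S :: "(nat set \<Rightarrow> nat) set" where S: "countable S"
      "\<And>F t. finite F \<Longrightarrow> \<exists>s\<in>S. \<forall>A\<in>F. s A = t A"
    using countable_extends_finite_maps by blast
  obtain p where p: "\<And>s. thread s (p s)" using thread_exists[OF False] by metis
  have step: "\<exists>x. thread_step s (p s) \<alpha> x (p s \<alpha>)" for s \<alpha> using p unfolding thread_def by blast
  have "\<exists>x\<in>topspace Y. \<forall>\<beta>\<in>UNIV. (p s \<beta>, x) \<in> R (upto \<beta>)" for s
  proof (rule coherent_limit[OF False])
    show "p s \<beta> \<in> topspace Y" for \<beta>
      using step[of s \<beta>] thread_step_topspace(2) by blast
    show "(p s \<gamma>, p s \<beta>) \<in> R (upto \<gamma>)" if "(\<gamma>, \<beta>) \<in> r" for \<beta> \<gamma>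
      using step[of s \<beta>] that thread_step_coherent by blast
  qed
  then have "\<forall>s. \<exists>x. x \<in> topspace Y \<and> (\<forall>\<beta>. (p s \<beta>, x) \<in> R (upto \<beta>))" by blast
  then obtain q where q: "\<And>s. q s \<in> topspace Y" "\<And>s \<beta>. (p s \<beta>, q s) \<in> R (upto \<beta>)" by metis
  have "q ` S \<inter> W \<noteq> {}" if W: "openin Y W" "W \<noteq> {}" for W
  proof -
    \<comment> \<open>By \<open>separating\<close>, points related by \<open>R UNIV\<close> are
      equal, so every set is saturated.\<close>
    have "R UNIV `` W \<subseteq> W" using separating by (auto simp: R_def)
    then obtain \<beta> U where U: "openin Y U" "U \<noteq> {}" "R (upto \<beta>) `` U \<subseteq> U" "U \<subseteq> W"
      using limit_step[OF W, of UNIV] by blast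
    then obtain F t where F: "finite F"
        "\<forall>s p. thread s p \<longrightarrow> (\<forall>\<beta>\<in>F. s \<beta> = t \<beta>) \<longrightarrow> p \<beta> \<in> U"
      using finitely_forced[OF U(1-3)] by blast
    obtain s where s: "s \<in> S" "\<forall>\<beta>\<in>F. s \<beta> = t \<beta>" using S(2) F(1) by blast
    have "p s \<beta> \<in> U" using F(2) p s(2) by blast
    then have "q s \<in> U" using q(2)[of s \<beta>] U(3) by blast
    then show ?thesis using s(1) U(4) by blast
  qed
  then have "Y closure_of (q ` S) = topspace Y" unfolding dense_intersects_open by blast
  then show ?thesis unfolding separable_space_def
    using S(1) q(1) by (intro exI[of _ "q ` S"]) auto
qed

end

theorem separable: "separable_space Y"
  using strict_well_order_exists separable_if_well_ordered by metis

end

subsection \<open>Gyrogroups and their invariant subgyrogroups\<close>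

context gyrogroup
begin

abbreviation zero where "zero \<equiv> gyro_zero G add"
abbreviation neg where "neg \<equiv> gyro_inv G add"
notation add (infixl "\<oplus>" 65)

lemma zero_props: "zero \<in> G \<and> (\<forall>a\<in>G. zero \<oplus> a = a \<and> a \<oplus> zero = a)"
  unfolding gyro_zero_def by (rule theI') (rule G1)

lemma zero_closed [simp]: "zero \<in> G"
  and zero_left [simp]: "a \<in> G \<Longrightarrow> zero \<oplus> a = a"
  and zero_right [simp]: "a \<in> G \<Longrightarrow> a \<oplus> zero = a"
  using zero_props by auto

lemma neg_props: "x \<in> G \<Longrightarrow> neg x \<in> G \<and> neg x \<oplus> x = zero \<and> x \<oplus> neg x = zero"
  unfolding gyro_inv_def by (rule theI') (rule G2)

lemma neg_closed [simp]: "x \<in> G \<Longrightarrow> neg x \<in> G"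
  and neg_left [simp]: "x \<in> G \<Longrightarrow> neg x \<oplus> x = zero"
  and neg_right [simp]: "x \<in> G \<Longrightarrow> x \<oplus> neg x = zero"
  using neg_props by auto

lemma neg_unique: "x \<in> G \<Longrightarrow> y \<in> G \<Longrightarrow> y \<oplus> x = zero \<Longrightarrow> x \<oplus> y = zero \<Longrightarrow> neg x = y"
  using G2[of x] neg_props[of x] by blast

lemma neg_neg [simp]: "x \<in> G \<Longrightarrow> neg (neg x) = x"
  by (simp add: neg_unique)

lemma gyr_closed [simp]: "x \<in> G \<Longrightarrow> y \<in> G \<Longrightarrow> z \<in> G \<Longrightarrow> gyr x y z \<in> G"
  using G3_automorphism[of x y] bij_betwE by (fastforce simp: gyro_automorphism_def)

lemma gyr_inj:
  assumes "x \<in> G" "y \<in> G" "a \<in> G" "b \<in> G" "gyr x y a = gyr x y b"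
  shows "a = b"
proof -
  have "inj_on (gyr x y) G"
    using G3_automorphism[OF assms(1,2)] by (simp add: gyro_automorphism_def bij_betw_def)
  then show ?thesis using assms by (simp add: inj_on_def)
qed

lemma gyr_add: "x \<in> G \<Longrightarrow> y \<in> G \<Longrightarrow> a \<in> G \<Longrightarrow> b \<in> G \<Longrightarrow> gyr x y (a \<oplus> b) = gyr x y a \<oplus> gyr x y b"
  using G3_automorphism[of x y] by (simp add: gyro_automorphism_def)

text \<open>Adding \<open>neg a\<close> on the left turns the two sides into
  \<open>gyr (neg a) a b\<close> and \<open>gyr (neg a) a c\<close>, and gyrations are injective.
  That this gyration is the identity is derived only afterwards.\<close>

lemma left_cancel:
  assumes "a \<in> G" "b \<in> G" "c \<in> G" "a \<oplus> b = a \<oplus> c"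
  shows "b = c"
proof -
  have "zero \<oplus> gyr (neg a) a b = zero \<oplus> gyr (neg a) a c"
    using G3_assoc[of "neg a" a b] G3_assoc[of "neg a" a c] assms by simp
  then show ?thesis using assms gyr_inj[of "neg a" a b c] by simp
qed

lemma gyr_zero_left [simp]: "a \<in> G \<Longrightarrow> z \<in> G \<Longrightarrow> gyr zero a z = z"
  using G3_assoc[of zero a z] by (metis add_closed gyr_closed left_cancel zero_closed zero_left)

text \<open>G4 identifies this gyration with \<open>gyr zero a\<close>.\<close>

lemma gyr_neg_left [simp]: "a \<in> G \<Longrightarrow> z \<in> G \<Longrightarrow> gyr (neg a) a z = z"
  using G4[of "neg a" a z] by simp

lemma neg_add_cancel [simp]: "a \<in> G \<Longrightarrow> b \<in> G \<Longrightarrow> neg a \<oplus> (a \<oplus> b) = b"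
  using G3_assoc[of "neg a" a b] by simp

lemma add_neg_cancel [simp]: "a \<in> G \<Longrightarrow> b \<in> G \<Longrightarrow> a \<oplus> (neg a \<oplus> b) = b"
  using neg_add_cancel[of "neg a" b] by simp

lemma left_solution:
  assumes "a \<in> G" "b \<in> G" "c \<in> G"
  shows "a \<oplus> b = c \<longleftrightarrow> b = neg a \<oplus> c"
  using assms by auto

lemma zero_unique: "a \<in> G \<Longrightarrow> a \<oplus> a = a \<Longrightarrow> a = zero"
  using left_cancel[of a a zero] by simp

lemma gyr_zero [simp]:
  assumes "x \<in> G" "y \<in> G"
  shows "gyr x y zero = zero"
proof (rule zero_unique)
  show "gyr x y zero \<oplus> gyr x y zero = gyr x y zero"
    using gyr_add[OF assms zero_closed zero_closed] by simp
qed (use assms in simp)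

lemma gyr_neg:
  assumes "x \<in> G" "y \<in> G" "a \<in> G"
  shows "gyr x y (neg a) = neg (gyr x y a)"
proof (rule neg_unique[symmetric])
  show "gyr x y (neg a) \<oplus> gyr x y a = zero"
    using gyr_add[OF assms(1,2) neg_closed[OF assms(3)] assms(3)] assms by simp
  show "gyr x y a \<oplus> gyr x y (neg a) = zero"
    using gyr_add[OF assms(1-3) neg_closed[OF assms(3)]] assms by simp
qed (use assms in simp_all)

text \<open>In a group this is \<open>-a + c = (-a + b) + (-b + c)\<close>; the gyration is a
  correction that gyration-invariant sets absorb.\<close>

lemma diff_trans:
  assumes "a \<in> G" "b \<in> G" "c \<in> G"
  shows "neg a \<oplus> c = (neg a \<oplus> b) \<oplus> gyr (neg a) b (neg b \<oplus> c)"
  using G3_assoc[of "neg a" b "neg b \<oplus> c"] assms by (simp add: add_closed)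

lemma diff_swap:
  assumes "a \<in> G" "b \<in> G"
  shows "gyr (neg a) b (neg b \<oplus> a) = neg (neg a \<oplus> b)"
proof -
  have "(neg a \<oplus> b) \<oplus> gyr (neg a) b (neg b \<oplus> a) = zero"
    using diff_trans[of a b a] assms by simp
  then show ?thesis
    using left_solution[of "neg a \<oplus> b" "gyr (neg a) b (neg b \<oplus> a)" zero] assms
    by (simp add: add_closed)
qed

definition gyr_invariant :: "'a set \<Rightarrow> bool"
  where "gyr_invariant V \<longleftrightarrow> V \<subseteq> G \<and> (\<forall>x\<in>G. \<forall>y\<in>G. \<forall>z\<in>G. gyr x y z \<in> V \<longleftrightarrow> z \<in> V)"

lemma gyr_invariantD:
  "gyr_invariant V \<Longrightarrow> x \<in> G \<Longrightarrow> y \<in> G \<Longrightarrow> z \<in> G \<Longrightarrow> gyr x y z \<in> V \<longleftrightarrow> z \<in> V"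
  by (simp add: gyr_invariant_def)

text \<open>For a symmetric gyration-invariant \<open>V\<close> with \<open>V \<oplus> V \<subseteq> W\<close>, the relations
  \<open>\<ominus>x \<oplus> y \<in> V\<close> behave as entourages of a left-invariant uniformity.\<close>

lemma diff_mem_sym:
  assumes "gyr_invariant V" "\<And>v. v \<in> V \<Longrightarrow> neg v \<in> V" "a \<in> G" "b \<in> G" "neg a \<oplus> b \<in> V"
  shows "neg b \<oplus> a \<in> V"
  using gyr_invariantD[OF assms(1), of "neg a" b "neg b \<oplus> a"] diff_swap[OF assms(3,4)]
    assms(2)[OF assms(5)] assms(3,4) by (simp add: add_closed)

lemma diff_mem_trans:
  assumes "gyr_invariant V" "\<And>v w. v \<in> V \<Longrightarrow> w \<in> V \<Longrightarrow> v \<oplus> w \<in> W"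
    and "a \<in> G" "b \<in> G" "c \<in> G" "neg a \<oplus> b \<in> V" "neg b \<oplus> c \<in> V"
  shows "neg a \<oplus> c \<in> W"
proof -
  have "gyr (neg a) b (neg b \<oplus> c) \<in> V"
    using gyr_invariantD[OF assms(1), of "neg a" b "neg b \<oplus> c"] assms by (simp add: add_closed)
  then show ?thesis using diff_trans[OF assms(3-5)] assms(2,6) by simp
qed

definition invariant_sub :: "'a set \<Rightarrow> bool"
  where "invariant_sub N \<longleftrightarrow> gyr_invariant N \<and> zero \<in> N \<and> (\<forall>a\<in>N. neg a \<in> N) \<and>
    (\<forall>a\<in>N. \<forall>b\<in>N. a \<oplus> b \<in> N)"

definition coset_rel :: "'a set \<Rightarrow> 'a set \<Rightarrow> 'a rel"
  where "coset_rel K N = {(x, y). x \<in> K \<and> y \<in> K \<and> neg x \<oplus> y \<in> N}"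

lemma equiv_coset_rel:
  assumes "invariant_sub N" "K \<subseteq> G"
  shows "equiv K (coset_rel K N)"
proof (rule equivI)
  have N: "gyr_invariant N" "\<And>v. v \<in> N \<Longrightarrow> neg v \<in> N"
      "\<And>v w. v \<in> N \<Longrightarrow> w \<in> N \<Longrightarrow> v \<oplus> w \<in> N" "zero \<in> N"
    using assms(1) by (simp_all add: invariant_sub_def)
  show "coset_rel K N \<subseteq> K \<times> K" by (auto simp: coset_rel_def)
  show "refl_on K (coset_rel K N)"
    using N(4) assms(2) by (auto simp: coset_rel_def refl_on_def subset_iff)
  show "sym (coset_rel K N)"
    unfolding coset_rel_def sym_def using diff_mem_sym[OF N(1,2)] assms(2) by auto
  show "trans (coset_rel K N)"
  proof (rule transI)
    fix x y z assume "(x, y) \<in> coset_rel K N" "(y, z) \<in> coset_rel K N"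
    then show "(x, z) \<in> coset_rel K N"
      unfolding coset_rel_def using diff_mem_trans[OF N(1,3), of x y z] assms(2) by auto
  qed
qed

lemma invariant_sub_Inter:
  assumes "\<And>i. i \<in> I \<Longrightarrow> invariant_sub (N i)" "invariant_sub K"
  shows "invariant_sub (K \<inter> (\<Inter>i\<in>I. N i))"
  using assms by (simp add: invariant_sub_def gyr_invariant_def subset_iff)

text \<open>Written as a sum, the saturation of a compact set modulo a compact \<open>N\<close> is a
  continuous image of a compact product.\<close>

lemma Image_coset_rel:
  assumes "invariant_sub K" "N \<subseteq> K" "A \<subseteq> K"
  shows "coset_rel K N `` A = case_prod add ` (A \<times> N)"
proof -
  have K: "K \<subseteq> G" "\<And>a b. a \<in> K \<Longrightarrow> b \<in> K \<Longrightarrow> a \<oplus> b \<in> K"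
    using assms(1) by (auto simp: invariant_sub_def gyr_invariant_def)
  have "x \<oplus> n \<in> coset_rel K N `` A" if "x \<in> A" "n \<in> N" for x n
  proof -
    have "x \<in> K" "n \<in> K" using that assms(2,3) by auto
    then have "x \<in> G" "n \<in> G" "x \<in> K" "x \<oplus> n \<in> K" using K by auto
    then have "(x, x \<oplus> n) \<in> coset_rel K N" using that by (simp add: coset_rel_def)
    then show ?thesis using that by blast
  qed
  moreover have "y \<in> case_prod add ` (A \<times> N)" if "x \<in> A" "(x, y) \<in> coset_rel K N" for x y
  proof -
    have "x \<in> G" "y \<in> G" "neg x \<oplus> y \<in> N" using that K by (auto simp: coset_rel_def)
    then show ?thesis using that(1) by (intro image_eqI[of _ _ "(x, neg x \<oplus> y)"]) auto
  qed
  ultimately show ?thesis by auto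
qed

end

section \<open>Continuity and coset saturations in topological gyrogroups\<close>

context topological_gyrogroup
begin

lemma continuous_add:
  assumes "continuous_map S T f" "continuous_map S T g"
  shows "continuous_map S T (\<lambda>x. f x \<oplus> g x)"
  using continuous_map_compose[OF continuous_map_pairedI[OF assms] add_continuous]
  by (simp add: o_def)

lemma continuous_left_translation: "a \<in> topspace T \<Longrightarrow> continuous_map T T (\<lambda>x. a \<oplus> x)"
  by (intro continuous_add) auto

lemma continuous_right_translation: "a \<in> topspace T \<Longrightarrow> continuous_map T T (\<lambda>x. x \<oplus> a)"
  by (intro continuous_add) auto

lemma openin_diff_preimage:
  assumes "openin T U" "x \<in> topspace T"
  shows "openin T {y \<in> topspace T. neg x \<oplus> y \<in> U}"
  by (rule openin_continuous_map_preimage[OF continuous_left_translation assms(1)])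
    (use assms(2) in simp)

text \<open>By symmetry of the coset relation the saturation is a union of preimages, rather than
  images, under right translations by elements of \<open>N\<close>, so continuity of these
  translations suffices.\<close>

lemma Image_coset_rel_open:
  assumes K: "invariant_sub K" and N: "invariant_sub N" "N \<subseteq> K"
    and U: "openin (subtopology T K) U"
  shows "openin (subtopology T K) (coset_rel K N `` U)"
proof -
  have KG: "K \<subseteq> topspace T" "\<And>a b. a \<in> K \<Longrightarrow> b \<in> K \<Longrightarrow> a \<oplus> b \<in> K"
    using K by (auto simp: invariant_sub_def gyr_invariant_def)
  obtain U' where U': "openin T U'" "U = U' \<inter> K" using U openin_subtopology by metis
  have eq: "coset_rel K N `` U = (\<Union>n\<in>N. {y \<in> topspace T. y \<oplus> n \<in> U'}) \<inter> K"
  proof (intro equalityI subsetI)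
    fix y assume "y \<in> coset_rel K N `` U"
    then obtain x where x: "x \<in> U" "(x, y) \<in> coset_rel K N" by blast
    then have "(y, x) \<in> coset_rel K N"
      using equiv_coset_rel[OF N(1) KG(1)] by (meson equiv_def symD)
    then have "y \<in> K" "neg y \<oplus> x \<in> N" "y \<oplus> (neg y \<oplus> x) \<in> U'"
      using x(1) U'(2) KG(1) by (auto simp: coset_rel_def subset_iff)
    then show "y \<in> (\<Union>n\<in>N. {y \<in> topspace T. y \<oplus> n \<in> U'}) \<inter> K" using KG(1) by blast
  next
    fix y assume "y \<in> (\<Union>n\<in>N. {y \<in> topspace T. y \<oplus> n \<in> U'}) \<inter> K"
    then obtain n where n: "n \<in> N" "y \<in> K" "y \<oplus> n \<in> U'" by blast
    then have "n \<in> K" using N(2) by blast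
    then have "y \<oplus> n \<in> U" "(y, y \<oplus> n) \<in> coset_rel K N"
      using n U'(2) KG by (auto simp: coset_rel_def subset_iff)
    then show "y \<in> coset_rel K N `` U"
      using equiv_coset_rel[OF N(1) KG(1)] by (meson equiv_def symD Image_iff)
  qed
  have "openin T (\<Union>n\<in>N. {y \<in> topspace T. y \<oplus> n \<in> U'})"
  proof (rule openin_Union, clarify)
    fix n assume "n \<in> N"
    then have "n \<in> topspace T" using N(2) KG(1) by blast
    then show "openin T {y \<in> topspace T. y \<oplus> n \<in> U'}"
      using openin_continuous_map_preimage[OF continuous_right_translation U'(1)] by simp
  qed
  then show ?thesis unfolding eq openin_subtopology by blast
qed

text \<open>Both \<open>C\<close> and \<open>N\<close> are compact as closed subsets of
  \<open>K\<close>, so their sum is compact, hence closed in the Hausdorff space.\<close>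

lemma Image_coset_rel_closed:
  assumes K: "invariant_sub K" "compactin T K" and N: "N \<subseteq> K" "closedin T N"
    and T: "Hausdorff_space T" and C: "closedin (subtopology T K) C"
  shows "closedin (subtopology T K) (coset_rel K N `` C)"
proof -
  have "closedin T K" using K(2) T compactin_imp_closedin by blast
  then have "closedin T C" "C \<subseteq> K"
    using C closedin_trans_full closedin_subset[OF C] by auto
  then have "compactin T C" "compactin T N"
    using closed_compactin[OF K(2)] N by auto
  then have "compactin (prod_topology T T) (C \<times> N)" by (simp add: compactin_Times)
  then have "compactin T (case_prod add ` (C \<times> N))" using add_continuous image_compactin by blast
  then have "closedin T (coset_rel K N `` C)"
    using compactin_imp_closedin T Image_coset_rel[OF K(1) N(1) \<open>C \<subseteq> K\<close>] by metis
  then show ?thesis by (rule closedin_subset_topspace) (auto simp: coset_rel_def)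
qed

subsection \<open>Chains of invariant neighbourhoods\<close>

text \<open>Members of the gyration-invariant base need not be open; hence the condition on the
  interior.\<close>

definition invariant_nbhd :: "'a set \<Rightarrow> bool"
  where "invariant_nbhd V \<longleftrightarrow>
    gyr_invariant V \<and> (\<forall>v\<in>V. neg v \<in> V) \<and> zero \<in> T interior_of V"

definition nbhd_chain :: "(nat \<Rightarrow> 'a set) \<Rightarrow> bool"
  where "nbhd_chain V \<longleftrightarrow>
    (\<forall>n. invariant_nbhd (V n) \<and> (\<forall>v\<in>V (Suc n). \<forall>w\<in>V (Suc n). v \<oplus> w \<in> V n))"

lemma nbhd_chainD:
  assumes "nbhd_chain V"
  shows "gyr_invariant (V n)" "V n \<subseteq> topspace T" "v \<in> V n \<Longrightarrow> neg v \<in> V n"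
    "zero \<in> T interior_of V n" "zero \<in> V n"
    "v \<in> V (Suc n) \<Longrightarrow> w \<in> V (Suc n) \<Longrightarrow> v \<oplus> w \<in> V n"
  using assms interior_of_subset[of T "V n"]
  by (auto simp: nbhd_chain_def invariant_nbhd_def gyr_invariant_def)

lemma nbhd_chain_antimono:
  assumes "nbhd_chain V" "m \<le> n"
  shows "V n \<subseteq> V m"
proof (rule lift_Suc_antimono_le[OF _ assms(2)])
  fix n
  show "V (Suc n) \<subseteq> V n"
  proof
    fix v assume v: "v \<in> V (Suc n)"
    then have "v \<oplus> zero \<in> V n" using nbhd_chainD(5,6)[OF assms(1)] by blast
    then show "v \<in> V n" using v nbhd_chainD(2)[OF assms(1), of "Suc n"] by auto
  qed
qed

lemma nbhd_chain_diff_sym: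
  assumes "nbhd_chain V" "a \<in> topspace T" "b \<in> topspace T" "neg a \<oplus> b \<in> V n"
  shows "neg b \<oplus> a \<in> V n"
  using nbhd_chainD(1,3)[OF assms(1)] assms(2-4) by (rule diff_mem_sym)

lemma nbhd_chain_diff_trans:
  assumes "nbhd_chain V" "a \<in> topspace T" "b \<in> topspace T" "c \<in> topspace T"
    and "neg a \<oplus> b \<in> V (Suc n)" "neg b \<oplus> c \<in> V (Suc n)"
  shows "neg a \<oplus> c \<in> V n"
  using nbhd_chainD(1,6)[OF assms(1)] assms(2-6) by (rule diff_mem_trans)

text \<open>The neighbourhood \<open>y \<oplus> V (Suc n)\<close> of \<open>y\<close> meets
  \<open>V (Suc n)\<close> in some \<open>z\<close>, and then
  \<open>y = z \<oplus> (neg z \<oplus> y)\<close> is a sum of two members of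
  \<open>V (Suc n)\<close>.\<close>

lemma nbhd_chain_closure:
  assumes V: "nbhd_chain V"
  shows "T closure_of V (Suc n) \<subseteq> V n"
proof
  fix y assume y: "y \<in> T closure_of V (Suc n)"
  then have yT: "y \<in> topspace T" by (simp add: in_closure_of)
  define U where "U = {z \<in> topspace T. neg y \<oplus> z \<in> T interior_of V (Suc n)}"
  have "openin T U" unfolding U_def using yT by (intro openin_diff_preimage) auto
  moreover have "y \<in> U" using yT nbhd_chainD(4)[OF V] by (simp add: U_def)
  ultimately obtain z where z: "z \<in> V (Suc n)" "z \<in> U"
    using y unfolding in_closure_of by blast
  then have "neg y \<oplus> z \<in> V (Suc n)" using interior_of_subset[of T "V (Suc n)"] by (auto simp: U_def)
  then have "neg z \<oplus> y \<in> V (Suc n)" using nbhd_chain_diff_sym[OF V yT] z by (auto simp: U_def)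
  then have "z \<oplus> (neg z \<oplus> y) \<in> V n" using nbhd_chainD(6)[OF V z(1)] by blast
  then show "y \<in> V n" using yT z(2) by (simp add: U_def)
qed

lemma invariant_sub_nbhd_chain:
  assumes V: "nbhd_chain V"
  shows "invariant_sub (\<Inter>n. V n)"
proof -
  have "gyr_invariant (\<Inter>n. V n)"
    unfolding gyr_invariant_def
  proof (intro conjI ballI)
    show "(\<Inter>n. V n) \<subseteq> topspace T" using nbhd_chainD(2)[OF V] by blast
    show "gyr x y z \<in> (\<Inter>n. V n) \<longleftrightarrow> z \<in> (\<Inter>n. V n)"
      if "x \<in> topspace T" "y \<in> topspace T" "z \<in> topspace T" for x y z
      using gyr_invariantD[OF nbhd_chainD(1)[OF V] that] by simp
  qed
  then show ?thesis
    using nbhd_chainD(3,5,6)[OF V] unfolding invariant_sub_def by simp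
qed

lemma closedin_nbhd_chain:
  assumes V: "nbhd_chain V"
  shows "closedin T (\<Inter>n. V n)"
proof -
  have "(\<Inter>n. V n) = (\<Inter>n. T closure_of V n)"
    using nbhd_chain_closure[OF V] closure_of_subset[OF nbhd_chainD(2)[OF V]] by blast
  then show ?thesis by (simp add: closedin_INT)
qed

text \<open>The closures of the \<open>V n\<close> have the same intersection as the
  \<open>V n\<close>, so by compactness one of them misses \<open>F - W\<close>.\<close>

lemma nbhd_chain_base:
  assumes V: "nbhd_chain V" and F: "compactin T F"
    and base: "\<And>W. openin T W \<Longrightarrow> F \<subseteq> W \<Longrightarrow> \<exists>n. V n \<subseteq> W"
    and W: "openin T W" "(\<Inter>n. V n) \<subseteq> W"
  shows "\<exists>n. V n \<subseteq> W"
proof -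
  have FT: "F \<subseteq> topspace T" using F compactin_subset_topspace by blast
  have "closedin T (topspace T - W)" using W(1) by blast
  then have "compactin T ((topspace T - W) \<inter> F)" using F by (rule closed_Int_compactin)
  moreover have "(topspace T - W) \<inter> F = F - W" using FT by blast
  ultimately have cpt: "compactin T (F - W)" by simp
  have "\<exists>n. (F - W) \<inter> T closure_of V n = {}"
  proof (rule ccontr)
    assume neg: "\<not> ?thesis"
    have "\<Inter>((\<lambda>n. (F - W) \<inter> T closure_of V n) ` UNIV) \<noteq> {}"
    proof (rule compact_space_chain_Inter_nonempty)
      show "compact_space (subtopology T (F - W))" using cpt by (simp add: compact_space_subtopology)
      show "closedin (subtopology T (F - W)) ((F - W) \<inter> T closure_of V n)" for n
        by (simp add: closedin_subtopology_Int_closed)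
      show "(F - W) \<inter> T closure_of V n \<noteq> {}" for n using neg by blast
      show "(F - W) \<inter> T closure_of V m \<subseteq> (F - W) \<inter> T closure_of V n \<or>
        (F - W) \<inter> T closure_of V n \<subseteq> (F - W) \<inter> T closure_of V m" for m n
        using closure_of_mono[OF nbhd_chain_antimono[OF V]] by (meson Int_mono linear subset_refl)
    qed
    then obtain y where y: "y \<in> F - W" "\<And>n. y \<in> T closure_of V n" by blast
    then show False using nbhd_chain_closure[OF V] W(2) by blast
  qed
  then obtain n where n: "(F - W) \<inter> T closure_of V n = {}" by blast
  \<comment> \<open>Adding the complement of the closure yields a neighbourhood of all of
    \<open>F\<close>; the added part is discarded again by passing from \<open>V m\<close> to
    \<open>V (max m n)\<close>.\<close>
  have "openin T (W \<union> (topspace T - T closure_of V n))" using W(1) by (intro openin_Un openin_diff) auto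
  moreover have "F \<subseteq> W \<union> (topspace T - T closure_of V n)" using n FT by blast
  ultimately obtain m where m: "V m \<subseteq> W \<union> (topspace T - T closure_of V n)" using base by blast
  have "V (max m n) \<subseteq> V m" "V (max m n) \<subseteq> T closure_of V n"
    using nbhd_chain_antimono[OF V, of _ "max m n"] closure_of_subset[OF nbhd_chainD(2)[OF V], of n]
    by (simp, meson max.cobounded2 order_trans)
  then show ?thesis using m by blast
qed

section \<open>Chains with compact intersection, featheredness and narrowness\<close>

definition compact_chain :: "(nat \<Rightarrow> 'a set) \<Rightarrow> bool"
  where "compact_chain V \<longleftrightarrow> nbhd_chain V \<and> compactin T (\<Inter>n. V n) \<and>
    (\<forall>W. openin T W \<and> (\<Inter>n. V n) \<subseteq> W \<longrightarrow> (\<exists>n. V n \<subseteq> W))"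

lemma compact_chain_translate:
  assumes V: "compact_chain V" and U: "openin T U" and x: "x \<in> topspace T"
    and sub: "\<And>y. y \<in> topspace T \<Longrightarrow> neg x \<oplus> y \<in> (\<Inter>n. V n) \<Longrightarrow> y \<in> U"
  shows "\<exists>n. \<forall>y\<in>topspace T. neg x \<oplus> y \<in> V n \<longrightarrow> y \<in> U"
proof -
  let ?W = "{v \<in> topspace T. x \<oplus> v \<in> U}"
  have chain: "nbhd_chain V" using V by (simp add: compact_chain_def)
  have "openin T ?W"
    using openin_continuous_map_preimage[OF continuous_left_translation[OF x] U] .
  moreover have "(\<Inter>n. V n) \<subseteq> ?W"
  proof
    fix v assume v: "v \<in> (\<Inter>n. V n)"
    then have "v \<in> topspace T" using nbhd_chainD(2)[OF chain] by blast
    then show "v \<in> ?W" using sub[of "x \<oplus> v"] x v by (simp add: add_closed)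
  qed
  ultimately obtain n where n: "V n \<subseteq> ?W" using V unfolding compact_chain_def by blast
  show ?thesis
  proof (intro exI[of _ n] ballI impI)
    fix y assume "y \<in> topspace T" "neg x \<oplus> y \<in> V n"
    then have "x \<oplus> (neg x \<oplus> y) \<in> U" using n by blast
    then show "y \<in> U" using x \<open>y \<in> topspace T\<close> by simp
  qed
qed

text \<open>Left translation by \<open>neg a\<close>, for a point \<open>a\<close> of the given
  compact set, moves that set to one containing zero, together with its countable base.\<close>

lemma feathered_at_zero:
  assumes "feathered T"
  shows "\<exists>F P. compactin T F \<and> zero \<in> F \<and> (\<forall>n. openin T (P n) \<and> F \<subseteq> P n) \<and>
    (\<forall>W. openin T W \<and> F \<subseteq> W \<longrightarrow> (\<exists>n :: nat. P n \<subseteq> W))"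
proof -
  obtain F \<gamma> where F: "F \<noteq> {}" "compactin T F" "countable \<gamma>" "base_at_set T F \<gamma>"
    using assms by (auto simp: feathered_def countable_character_def)
  have FT: "F \<subseteq> topspace T" using F(2) compactin_subset_topspace by blast
  \<comment> \<open>\<open>topspace T\<close> is an open set containing \<open>F\<close>.
    Nonemptiness ensures that \<open>from_nat_into \<gamma>\<close> takes values in
    \<open>\<gamma>\<close>.\<close>
  have "\<gamma> \<noteq> {}" using F(4) FT by (auto simp: base_at_set_def)
  then have Q: "openin T (from_nat_into \<gamma> n)" "F \<subseteq> from_nat_into \<gamma> n" for n
    using F(4) from_nat_into[of \<gamma> n] by (auto simp: base_at_set_def)
  obtain a where a: "a \<in> F" "a \<in> topspace T" using F(1) FT by blast
  let ?P = "\<lambda>n. {v \<in> topspace T. a \<oplus> v \<in> from_nat_into \<gamma> n}"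
  have F': "compactin T ((\<lambda>x. neg a \<oplus> x) ` F)"
    using image_compactin[OF F(2) continuous_left_translation] a(2) by simp
  have "zero \<in> (\<lambda>x. neg a \<oplus> x) ` F" using a by (intro image_eqI[of _ _ a]) auto
  moreover have "openin T (?P n)" for n
    using openin_continuous_map_preimage[OF continuous_left_translation[OF a(2)] Q(1)] .
  moreover have "(\<lambda>x. neg a \<oplus> x) ` F \<subseteq> ?P n" for n
    using Q(2)[of n] FT a(2) by (auto simp: add_closed subset_iff)
  moreover have "\<exists>n. ?P n \<subseteq> W" if W: "openin T W" "(\<lambda>x. neg a \<oplus> x) ` F \<subseteq> W" for W
  proof -
    have "F \<subseteq> {y \<in> topspace T. neg a \<oplus> y \<in> W}" using W(2) FT by blast
    then obtain S where S: "S \<in> \<gamma>" "S \<subseteq> {y \<in> topspace T. neg a \<oplus> y \<in> W}"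
      using F(4) openin_diff_preimage[OF W(1) a(2)] unfolding base_at_set_def by blast
    obtain n where n: "from_nat_into \<gamma> n = S" using from_nat_into_surj[OF F(3) S(1)] by blast
    have "?P n \<subseteq> W"
    proof clarify
      fix v assume v: "v \<in> topspace T" "a \<oplus> v \<in> from_nat_into \<gamma> n"
      then have "neg a \<oplus> (a \<oplus> v) \<in> W" using S(2) n by blast
      then show "v \<in> W" using v(1) a(2) by simp
    qed
    then show ?thesis by blast
  qed
  ultimately show ?thesis
    using F' by (intro exI[of _ "(\<lambda>x. neg a \<oplus> x) ` F"] exI[of _ ?P]) auto
qed

text \<open>This is \<omega>-narrowness: countably many left translates of each open neighbourhood
  of zero cover the space.\<close>

definition narrow :: bool
  where "narrow \<longleftrightarrow> (\<forall>P. openin T P \<and> zero \<in> P \<longrightarrow>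
    (\<exists>D. countable D \<and> D \<subseteq> topspace T \<and> (\<forall>x\<in>topspace T. \<exists>d\<in>D. neg d \<oplus> x \<in> P)))"

lemma narrow_chain:
  assumes "narrow" "nbhd_chain V"
  shows "\<exists>D. \<forall>n. countable (D n) \<and> D n \<subseteq> topspace T \<and>
    (\<forall>x\<in>topspace T. \<exists>d\<in>D n. neg d \<oplus> x \<in> T interior_of V n)"
proof (rule choice, rule allI)
  fix n
  show "\<exists>D. countable D \<and> D \<subseteq> topspace T \<and>
      (\<forall>x\<in>topspace T. \<exists>d\<in>D. neg d \<oplus> x \<in> T interior_of V n)"
    using assms(1) nbhd_chainD(4)[OF assms(2), of n] openin_interior_of[of T "V n"]
    unfolding narrow_def by blast
qed

text \<open>The family consists of the translates of \<open>T interior_of V n\<close> to the points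
  of \<open>D n\<close>. If the translate of \<open>V n\<close> to \<open>x\<close> lies in
  \<open>U\<close>, a point of \<open>D (Suc n)\<close> near \<open>x\<close> works, since two
  differences in \<open>V (Suc n)\<close> compose to one in \<open>V n\<close>.\<close>

lemma compact_chain_countable_base:
  assumes "narrow" and V: "compact_chain V"
  shows "\<exists>B :: nat \<Rightarrow> 'a set. (\<forall>i. openin T (B i)) \<and> (\<forall>U x. openin T U \<longrightarrow> x \<in> topspace T \<longrightarrow>
    (\<forall>y\<in>topspace T. neg x \<oplus> y \<in> (\<Inter>n. V n) \<longrightarrow> y \<in> U) \<longrightarrow> (\<exists>i. x \<in> B i \<and> B i \<subseteq> U))"
proof -
  have chain: "nbhd_chain V" using V by (simp add: compact_chain_def)
  obtain D where "\<forall>n. countable (D n) \<and> D n \<subseteq> topspace T \<and>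
      (\<forall>x\<in>topspace T. \<exists>d\<in>D n. neg d \<oplus> x \<in> T interior_of V n)"
    using narrow_chain[OF assms(1) chain] by blast
  then have D: "countable (D n)" "D n \<subseteq> topspace T"
      "x \<in> topspace T \<Longrightarrow> \<exists>d\<in>D n. neg d \<oplus> x \<in> T interior_of V n" for n x
    by blast+
  let ?b = "\<lambda>n d. {z \<in> topspace T. neg d \<oplus> z \<in> T interior_of V n}"
  define \<B> where "\<B> = (\<Union>n. ?b n ` D n)"
  have "countable \<B>" unfolding \<B>_def using D(1) by simp
  obtain d where "d \<in> D 0" using D(3)[OF zero_closed, of 0] by blast
  then have "\<B> \<noteq> {}" by (auto simp: \<B>_def)
  have "openin T b" if "b \<in> \<B>" for b
    using that D(2) unfolding \<B>_def by (auto intro!: openin_diff_preimage)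
  then have "\<forall>i. openin T (from_nat_into \<B> i)" using from_nat_into[OF \<open>\<B> \<noteq> {}\<close>] by blast
  moreover have "\<exists>i. x \<in> from_nat_into \<B> i \<and> from_nat_into \<B> i \<subseteq> U"
    if U: "openin T U" and x: "x \<in> topspace T"
      and sub: "\<forall>y\<in>topspace T. neg x \<oplus> y \<in> (\<Inter>n. V n) \<longrightarrow> y \<in> U" for U x
  proof -
    have "\<exists>n. \<forall>y\<in>topspace T. neg x \<oplus> y \<in> V n \<longrightarrow> y \<in> U"
      using V U x by (rule compact_chain_translate) (use sub in blast)
    then obtain n where n: "\<forall>y\<in>topspace T. neg x \<oplus> y \<in> V n \<longrightarrow> y \<in> U" by blast
    obtain d where d: "d \<in> D (Suc n)" "neg d \<oplus> x \<in> T interior_of V (Suc n)" using D(3)[OF x] by blast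
    have dT: "d \<in> topspace T" using d(1) D(2) by blast
    have "neg d \<oplus> x \<in> V (Suc n)" using d(2) interior_of_subset[of T "V (Suc n)"] by blast
    then have xd: "neg x \<oplus> d \<in> V (Suc n)" using nbhd_chain_diff_sym[OF chain dT x] by blast
    have "?b (Suc n) d \<subseteq> U"
    proof clarify
      fix z assume z: "z \<in> topspace T" "neg d \<oplus> z \<in> T interior_of V (Suc n)"
      then have "neg d \<oplus> z \<in> V (Suc n)" using interior_of_subset[of T "V (Suc n)"] by blast
      then show "z \<in> U" using n z(1) nbhd_chain_diff_trans[OF chain x dT z(1) xd] by blast
    qed
    moreover have "x \<in> ?b (Suc n) d" using d(2) x by blast
    moreover have "?b (Suc n) d \<in> \<B>" using d(1) unfolding \<B>_def by blast
    moreover from this obtain i where "from_nat_into \<B> i = ?b (Suc n) d"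
      using from_nat_into_surj[OF \<open>countable \<B>\<close>] by blast
    ultimately show ?thesis by (intro exI[of _ i]) simp
  qed
  ultimately show ?thesis by (intro exI[of _ "from_nat_into \<B>"]) blast
qed

section \<open>Separability of the compact part and of the whole space\<close>

text \<open>The tower theorem applies to the coset relations modulo the intersections
  \<open>M A\<close> of the chains.\<close>

lemma separable_compact_invariant_sub:
  fixes V :: "nat set \<Rightarrow> nat \<Rightarrow> 'a set"
  assumes "Hausdorff_space T" "narrow" and K: "invariant_sub K" "compactin T K"
    and V: "\<And>A. compact_chain (V A)" and sep: "(\<Inter>A. \<Inter>n. V A n) \<subseteq> {zero}"
  shows "separable_space (subtopology T K)"
proof -
  define M where "M A = (\<Inter>n. V A n)" for A
  have chain: "nbhd_chain (V A)" for A using V by (simp add: compact_chain_def)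
  have M: "invariant_sub (M A)" "closedin T (M A)" for A
    unfolding M_def using invariant_sub_nbhd_chain closedin_nbhd_chain chain by blast+
  have KT: "K \<subseteq> topspace T" "closedin T K" "topspace (subtopology T K) = K"
    using K(2) compactin_subset_topspace[OF K(2)] compactin_imp_closedin[OF assms(1)] by auto
  have Ksub: "\<And>a b. a \<in> K \<Longrightarrow> b \<in> K \<Longrightarrow> neg a \<oplus> b \<in> K" using K(1) by (simp add: invariant_sub_def)
  \<comment> \<open>Intersecting with \<open>K\<close> covers empty \<open>J\<close> as well:
    \<open>N {} = K\<close> matches the full relation on \<open>K\<close>.\<close>
  define N where "N J = K \<inter> (\<Inter>A\<in>J. M A)" for J
  have N: "invariant_sub (N J)" "N J \<subseteq> K" "closedin T (N J)" for J
  proof -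
    show "invariant_sub (N J)" unfolding N_def by (rule invariant_sub_Inter) (use M K in auto)
    show "N J \<subseteq> K" by (simp add: N_def)
    have "N J = \<Inter>(insert K (M ` J))" by (simp add: N_def)
    moreover have "closedin T (\<Inter>(insert K (M ` J)))"
      by (rule closedin_Inter) (use M(2) KT(2) in auto)
    ultimately show "closedin T (N J)" by simp
  qed
  have rel: "{(x, y). x \<in> topspace (subtopology T K) \<and> y \<in> topspace (subtopology T K) \<and>
      (\<forall>A\<in>J. (x, y) \<in> coset_rel K (M A))} = coset_rel K (N J)" for J
    unfolding KT(3) by (auto simp: coset_rel_def N_def Ksub)
  obtain B :: "nat set \<Rightarrow> nat \<Rightarrow> 'a set" where B: "\<And>A i. openin T (B A i)"
      "\<And>A U x. openin T U \<Longrightarrow> x \<in> topspace T \<Longrightarrow>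
        (\<forall>y\<in>topspace T. neg x \<oplus> y \<in> M A \<longrightarrow> y \<in> U) \<Longrightarrow> \<exists>i. x \<in> B A i \<and> B A i \<subseteq> U"
    using compact_chain_countable_base[OF assms(2) V, folded M_def] by metis
  have "open_equivalence_system (subtopology T K) (\<lambda>A. coset_rel K (M A)) (\<lambda>A i. B A i \<inter> K)"
  proof (unfold_locales, unfold rel)
    show "compact_space (subtopology T K)" using K(2) by (simp add: compact_space_subtopology)
    show "Hausdorff_space (subtopology T K)" using assms(1) by (simp add: Hausdorff_space_subtopology)
    show "equiv (topspace (subtopology T K)) (coset_rel K (M A))" for A
      unfolding KT(3) using M(1) KT(1) by (rule equiv_coset_rel)
    show "openin (subtopology T K) (coset_rel K (N J) `` U)" if "openin (subtopology T K) U" for U J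
      using K(1) N(1,2) that by (rule Image_coset_rel_open)
    show "closedin (subtopology T K) (coset_rel K (N J) `` C)"
      if "closedin (subtopology T K) C" for C J
      using K N(2,3) assms(1) that by (rule Image_coset_rel_closed)
    show "openin (subtopology T K) (B A i \<inter> K)" for A i using B(1) openin_subtopology by blast
    show "\<exists>i. x \<in> B A i \<inter> K \<and> B A i \<inter> K \<subseteq> U"
      if U: "openin (subtopology T K) U" and x: "x \<in> topspace (subtopology T K)"
        and sub: "coset_rel K (M A) `` {x} \<subseteq> U" for U x A
    proof -
      obtain U' where U': "openin T U'" "U = U' \<inter> K" using U openin_subtopology by metis
      have xK: "x \<in> K" "x \<in> topspace T" using x KT by auto
      \<comment> \<open>\<open>U\<close> is open only relative to \<open>K\<close>; adding the
        complement of the closed set \<open>K\<close> gives an open set of \<open>T\<close> that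
        contains the whole coset of \<open>x\<close> modulo \<open>M A\<close>, including its points
        outside \<open>K\<close>.\<close>
      have "openin T (U' \<union> (topspace T - K))" using U'(1) KT(2) by blast
      moreover have "\<forall>y\<in>topspace T. neg x \<oplus> y \<in> M A \<longrightarrow> y \<in> U' \<union> (topspace T - K)"
        using sub U'(2) xK(1) by (auto simp: coset_rel_def)
      ultimately obtain i where "x \<in> B A i" "B A i \<subseteq> U' \<union> (topspace T - K)"
        using B(2) xK(2) by meson
      then show ?thesis using xK(1) U'(2) by blast
    qed
    show "x = y" if "\<And>A. (x, y) \<in> coset_rel K (M A)" for x y
    proof -
      have "neg x \<oplus> y \<in> (\<Inter>A. \<Inter>n. V A n)" and K: "x \<in> K" "y \<in> K"
        using that by (auto simp: coset_rel_def M_def)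
      then have "neg x \<oplus> y = zero" using sep by blast
      moreover have "x \<in> topspace T" "y \<in> topspace T" using K KT(1) by auto
      ultimately show ?thesis using left_solution[of x zero y] by simp
    qed
  qed
  then show ?thesis by (rule open_equivalence_system.separable)
qed

text \<open>A nonempty open \<open>U\<close> has an open saturation modulo the compact subgyrogroup,
  and some \<open>d\<close> from the countable sets \<open>D n\<close> lies in it. The coset of
  \<open>d\<close> thus meets \<open>U\<close>, and so does the translate by \<open>d\<close> of a
  countable dense subset \<open>C\<close> of the subgyrogroup.\<close>

lemma separable_if_compact_chain:
  assumes "narrow" and V: "compact_chain V" and sepK: "separable_space (subtopology T (\<Inter>n. V n))"
  shows "separable_space T"
proof -
  let ?K = "\<Inter>n. V n"
  have chain: "nbhd_chain V" using V by (simp add: compact_chain_def)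
  have K: "invariant_sub ?K" "?K \<subseteq> topspace T"
    using invariant_sub_nbhd_chain[OF chain] by (auto simp: invariant_sub_def gyr_invariant_def)
  obtain C where C: "countable C" "C \<subseteq> ?K" "subtopology T ?K closure_of C = ?K"
    using sepK K(2) unfolding separable_space_def topspace_subtopology_subset[OF K(2)] by blast
  obtain D where "\<forall>n. countable (D n) \<and> D n \<subseteq> topspace T \<and>
      (\<forall>x\<in>topspace T. \<exists>d\<in>D n. neg d \<oplus> x \<in> T interior_of V n)"
    using narrow_chain[OF assms(1) chain] by blast
  then have D: "countable (D n)" "D n \<subseteq> topspace T"
      "x \<in> topspace T \<Longrightarrow> \<exists>d\<in>D n. neg d \<oplus> x \<in> T interior_of V n" for n x
    by blast+
  define S where "S = case_prod add ` ((\<Union>n. D n) \<times> C)"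
  have "S \<inter> U \<noteq> {}" if U: "openin T U" "U \<noteq> {}" for U
  proof -
    obtain x where x: "x \<in> U" "x \<in> topspace T" using U openin_subset by blast
    let ?Q = "coset_rel (topspace T) ?K `` U"
    have G: "invariant_sub (topspace T)"
      by (auto simp: invariant_sub_def gyr_invariant_def add_closed)
    have Q: "openin T ?Q"
      using Image_coset_rel_open[OF G K, of U] U(1) by simp
    have "\<exists>n. \<forall>y\<in>topspace T. neg x \<oplus> y \<in> V n \<longrightarrow> y \<in> ?Q"
    proof (rule compact_chain_translate[OF V Q x(2)])
      show "y \<in> ?Q" if "y \<in> topspace T" "neg x \<oplus> y \<in> ?K" for y
        using that x by (auto simp: coset_rel_def)
    qed
    then obtain n where n: "\<forall>y\<in>topspace T. neg x \<oplus> y \<in> V n \<longrightarrow> y \<in> ?Q" by blast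
    obtain d where d: "d \<in> D n" "neg d \<oplus> x \<in> T interior_of V n" using D(3)[OF x(2)] by blast
    have dT: "d \<in> topspace T" using d(1) D(2) by blast
    have "neg d \<oplus> x \<in> V n" using d(2) interior_of_subset[of T "V n"] by blast
    then have "d \<in> ?Q" using n dT nbhd_chain_diff_sym[OF chain dT x(2)] by blast
    then obtain u where u: "u \<in> U" "(u, d) \<in> coset_rel (topspace T) ?K" by blast
    then have "(d, u) \<in> coset_rel (topspace T) ?K"
      using equiv_coset_rel[OF K(1) subset_refl] by (meson equiv_def symD)
    then have du: "neg d \<oplus> u \<in> ?K" "u \<in> topspace T" by (simp_all add: coset_rel_def)
    define P where "P = {k \<in> topspace T. d \<oplus> k \<in> U} \<inter> ?K"
    have "openin T {k \<in> topspace T. d \<oplus> k \<in> U}"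
      using openin_continuous_map_preimage[OF continuous_left_translation[OF dT] U(1)] .
    then have "openin (subtopology T ?K) P" unfolding openin_subtopology P_def by blast
    moreover have "neg d \<oplus> u \<in> P" using du u(1) dT K(2) by (auto simp: P_def)
    moreover have "\<forall>P. openin (subtopology T ?K) P \<and> P \<noteq> {} \<longrightarrow> C \<inter> P \<noteq> {}"
      using C(3) dense_intersects_open[of "subtopology T ?K" C] topspace_subtopology_subset[OF K(2)]
      by simp
    ultimately have "C \<inter> P \<noteq> {}" by blast
    then obtain c where "c \<in> C" "d \<oplus> c \<in> U" by (auto simp: P_def)
    then have "d \<oplus> c \<in> S \<inter> U"
      using d(1) unfolding S_def by (intro IntI image_eqI[of _ _ "(d, c)"]) auto
    then show ?thesis by blast
  qed
  then have "T closure_of S = topspace T" unfolding dense_intersects_open by blast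
  moreover have "countable S" using C(1) D(1) by (simp add: S_def)
  moreover have "S \<subseteq> topspace T"
    unfolding S_def
  proof clarify
    fix n d c assume "d \<in> D n" "c \<in> C"
    then have "d \<in> topspace T" "c \<in> topspace T" using D(2)[of n] C(2) K(2) by blast+
    then show "d \<oplus> c \<in> topspace T" by (rule add_closed)
  qed
  ultimately show ?thesis unfolding separable_space_def by blast
qed

end

section \<open>Existence of chains from the gyration-invariant base\<close>

context strongly_topological_gyrogroup
begin

text \<open>Joint continuity at \<open>(zero, zero)\<close> supplies the condition on sums, the
  invariant base supplies invariance.\<close>

lemma invariant_nbhd_exists:
  assumes P: "openin T P" "zero \<in> P"
  shows "\<exists>V. invariant_nbhd V \<and> V \<subseteq> P \<and> (\<forall>v\<in>V. \<forall>w\<in>V. v \<oplus> w \<in> P)"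
proof -
  define Q where "Q = {p \<in> topspace (prod_topology T T). case_prod add p \<in> P}"
  have "openin (prod_topology T T) Q"
    unfolding Q_def using openin_continuous_map_preimage[OF add_continuous P(1)] .
  moreover have "(zero, zero) \<in> Q" using P(2) by (simp add: Q_def)
  ultimately have "\<exists>P1 P2. openin T P1 \<and> openin T P2 \<and> zero \<in> P1 \<and> zero \<in> P2 \<and> P1 \<times> P2 \<subseteq> Q"
    by (simp add: openin_prod_topology_alt)
  then obtain P1 P2 where P12: "openin T P1" "openin T P2" "zero \<in> P1" "zero \<in> P2"
      "P1 \<times> P2 \<subseteq> Q"
    by blast
  define P3 where "P3 = P \<inter> P1 \<inter> P2"
  have P3: "openin T P3" "zero \<in> P3" "P3 \<subseteq> P"
    unfolding P3_def using P P12 by auto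
  have P3_add: "v \<oplus> w \<in> P" if "v \<in> P3" "w \<in> P3" for v w
  proof -
    have "(v, w) \<in> P1 \<times> P2" using that by (simp add: P3_def)
    then show ?thesis using P12(5) by (auto simp: Q_def)
  qed
  obtain \<U> where \<U>: "nbhd_base_at T zero \<U>"
      "\<And>U x y. U \<in> \<U> \<Longrightarrow> x \<in> topspace T \<Longrightarrow> y \<in> topspace T \<Longrightarrow> gyr x y ` U = U"
    using gyr_invariant_base by metis
  then obtain U where U: "U \<in> \<U>" "U \<subseteq> P3" using P3 unfolding nbhd_base_at_def by meson
  have "U \<subseteq> topspace T \<and> (\<exists>W. openin T W \<and> zero \<in> W \<and> W \<subseteq> U)"
    using \<U>(1) U(1) by (simp add: nbhd_base_at_def)
  then obtain W where W: "U \<subseteq> topspace T" "openin T W" "zero \<in> W" "W \<subseteq> U" by blast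
  have gyrU: "gyr x y z \<in> U \<longleftrightarrow> z \<in> U"
    if xyz: "x \<in> topspace T" "y \<in> topspace T" "z \<in> topspace T" for x y z
  proof
    assume "gyr x y z \<in> U"
    then obtain u where u: "u \<in> U" "gyr x y z = gyr x y u" using \<U>(2)[OF U(1) xyz(1,2)] by blast
    then have "z = u" using gyr_inj[OF xyz, of u] W(1) by blast
    then show "z \<in> U" using u(1) by simp
  next
    assume "z \<in> U"
    then show "gyr x y z \<in> U" using \<U>(2)[OF U(1) xyz(1,2)] by blast
  qed
  \<comment> \<open>Symmetrising keeps invariance because gyrations commute with
    \<open>neg\<close>.\<close>
  define V where "V = {v \<in> U. neg v \<in> U}"
  have "gyr_invariant V"
    using W(1) gyrU by (auto simp: gyr_invariant_def V_def gyr_neg[symmetric])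
  moreover have "\<forall>v\<in>V. neg v \<in> V" using W(1) by (auto simp: V_def)
  moreover have "zero \<in> T interior_of V"
  proof -
    have "openin T (W \<inter> {v \<in> topspace T. neg v \<in> W})"
      using W(2) openin_continuous_map_preimage[OF inv_continuous W(2)] by blast
    moreover have "neg zero = zero" by (rule neg_unique) auto
    ultimately show ?thesis
      using W(3,4) unfolding interior_of_def V_def
      by (intro CollectI exI[of _ "W \<inter> {v \<in> topspace T. neg v \<in> W}"]) auto
  qed
  ultimately have "invariant_nbhd V" by (simp add: invariant_nbhd_def)
  moreover have "V \<subseteq> P3" using U(2) by (auto simp: V_def)
  ultimately show ?thesis using P3(3) P3_add by blast
qed

lemma nbhd_chain_exists:
  assumes P: "\<And>n. openin T (P n)" "\<And>n. zero \<in> P n"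
  shows "\<exists>V. nbhd_chain V \<and> (\<forall>n. V n \<subseteq> P n)"
proof -
  have "\<exists>V. \<forall>n. (invariant_nbhd (V n) \<and> V n \<subseteq> P n) \<and>
      (\<forall>v\<in>V (Suc n). \<forall>w\<in>V (Suc n). v \<oplus> w \<in> V n)"
  proof (rule dependent_nat_choice)
    show "\<exists>V. invariant_nbhd V \<and> V \<subseteq> P 0" using invariant_nbhd_exists[OF P] by blast
  next
    fix V n assume V: "invariant_nbhd V \<and> V \<subseteq> P n"
    have "openin T (T interior_of V \<inter> P (Suc n))" "zero \<in> T interior_of V \<inter> P (Suc n)"
      using P V by (auto simp: invariant_nbhd_def)
    from invariant_nbhd_exists[OF this]
    show "\<exists>V'. (invariant_nbhd V' \<and> V' \<subseteq> P (Suc n)) \<and> (\<forall>v\<in>V'. \<forall>w\<in>V'. v \<oplus> w \<in> V)"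
      using interior_of_subset[of T V] by blast
  qed
  then show ?thesis unfolding nbhd_chain_def by metis
qed

text \<open>With \<open>V n\<close> inside \<open>P n\<close>, where the \<open>P n\<close> form a
  base at a compact \<open>F\<close>, the intersection falls into \<open>F\<close>: in a Hausdorff
  space the complement of a point outside \<open>F\<close> is an open set around \<open>F\<close>.
  Being closed, the intersection is compact.\<close>

lemma compact_chain_exists:
  assumes "feathered T" "Hausdorff_space T" and C: "openin T C" "zero \<in> C"
  shows "\<exists>V. compact_chain V \<and> (\<Inter>n. V n) \<subseteq> C"
proof -
  obtain F P where F: "compactin T F" "zero \<in> F" and P: "\<And>n. openin T (P n)" "\<And>n. F \<subseteq> P n"
    and base: "\<And>W. openin T W \<Longrightarrow> F \<subseteq> W \<Longrightarrow> \<exists>n :: nat. P n \<subseteq> W"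
    using feathered_at_zero[OF assms(1)] by metis
  obtain V where V: "nbhd_chain V" "\<And>n. V n \<subseteq> P n \<inter> C"
    using nbhd_chain_exists[of "\<lambda>n. P n \<inter> C"] P F(2) C by blast
  have "(\<Inter>n. V n) \<subseteq> F"
  proof
    fix y assume y: "y \<in> (\<Inter>n. V n)"
    show "y \<in> F"
    proof (rule ccontr)
      assume "y \<notin> F"
      then have "F \<subseteq> topspace T - {y}" using compactin_subset_topspace[OF F(1)] by blast
      moreover have "openin T (topspace T - {y})"
        using assms(2) y nbhd_chainD(2)[OF V(1)]
        by (intro openin_diff closedin_Hausdorff_singleton) auto
      ultimately obtain n where "P n \<subseteq> topspace T - {y}" using base by blast
      then show False using V(2)[of n] y by blast
    qed
  qed
  then have "compactin T (\<Inter>n. V n)"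
    using closed_compactin F(1) closedin_nbhd_chain[OF V(1)] by blast
  moreover have "\<exists>n. V n \<subseteq> W" if "openin T W" "(\<Inter>n. V n) \<subseteq> W" for W
  proof (rule nbhd_chain_base[OF V(1) F(1) _ that])
    show "\<exists>n. V n \<subseteq> W" if "openin T W" "F \<subseteq> W" for W
      using base[OF that] V(2) by blast
  qed
  ultimately have "compact_chain V" using V(1) by (simp add: compact_chain_def)
  then show ?thesis using V(2) by blast
qed

text \<open>Chains enter twice: \<open>V0\<close> provides the compact subgyrogroup, and the
  \<open>V A\<close>, chosen with intersections inside the \<open>C A\<close>, separate its
  points.\<close>

theorem separable_if_narrow:
  fixes C :: "nat set \<Rightarrow> 'a set"
  assumes "feathered T" "Hausdorff_space T" "narrow"
    and C: "\<And>A. openin T (C A)" "\<And>A. zero \<in> C A" "(\<Inter>A. C A) \<subseteq> {zero}"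
  shows "separable_space T"
proof -
  obtain V where V: "\<And>A. compact_chain (V A)" "\<And>A. (\<Inter>n. V A n) \<subseteq> C A"
    using compact_chain_exists[OF assms(1,2) C(1,2)] by metis
  obtain V0 where V0: "compact_chain V0"
    using compact_chain_exists[OF assms(1,2) openin_topspace zero_closed] by blast
  have "invariant_sub (\<Inter>n. V0 n)" "compactin T (\<Inter>n. V0 n)"
    using V0 invariant_sub_nbhd_chain by (simp_all add: compact_chain_def)
  moreover have "(\<Inter>A. \<Inter>n. V A n) \<subseteq> {zero}"
    by (rule order_trans[OF INF_mono'[OF V(2)] C(3)])
  ultimately have "separable_space (subtopology T (\<Inter>n. V0 n))"
    using separable_compact_invariant_sub[where V = V, OF assms(2,3) _ _ V(1)] by blast
  then show ?thesis using separable_if_compact_chain[OF assms(3) V0] by blast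
qed

end

subsection \<open>Subgyrogroups of separable gyrogroups\<close>

text \<open>A countable dense set \<open>D\<close> of \<open>X\<close> may miss \<open>H\<close>, so
  each \<open>d\<close> in \<open>D\<close> that is \<open>V\<close>-close to some value of
  \<open>f\<close> is replaced by a point \<open>c d\<close> whose value is \<open>V\<close>-close
  to it. Every \<open>f x\<close> is \<open>V\<close>-close to such a \<open>d\<close>, and sums of
  two members of \<open>V\<close> lie in \<open>P'\<close>.\<close>

lemma subgyrogroup_of_separable_narrow:
  fixes f :: "'a \<Rightarrow> 'b"
  assumes G: "strongly_topological_gyrogroup G addG gyrG"
    and X: "strongly_topological_gyrogroup X addX gyrX"
    and sep: "separable_space X" and H: "H \<subseteq> topspace X"
    and iso: "topological_gyrogroup_iso G addG (subtopology X H) addX f"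
  shows "topological_gyrogroup.narrow G addG"
proof -
  interpret G: strongly_topological_gyrogroup G addG gyrG by (rule G)
  interpret X: strongly_topological_gyrogroup X addX gyrX by (rule X)
  have homeo: "homeomorphic_map G (subtopology X H) f"
    and add: "\<And>x y. x \<in> topspace G \<Longrightarrow> y \<in> topspace G \<Longrightarrow> f (addG x y) = addX (f x) (f y)"
    using iso by (auto simp: topological_gyrogroup_iso_def)
  have img: "f ` topspace G = H"
    using homeomorphic_imp_surjective_map[OF homeo] topspace_subtopology_subset[OF H] by simp
  have inj: "inj_on f (topspace G)" using homeo homeomorphic_imp_injective_map by blast
  have fX: "f x \<in> topspace X" if "x \<in> topspace G" for x using that img H by blast
  have zero: "f G.zero = X.zero"
    using add[of G.zero G.zero] fX X.zero_unique by simp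
  have diff: "f (addG (G.neg x) y) = addX (X.neg (f x)) (f y)"
    if "x \<in> topspace G" "y \<in> topspace G" for x y
  proof -
    have "f y = addX (f x) (f (addG (G.neg x) y))"
      using add[of x "addG (G.neg x) y"] that by (simp add: G.add_closed)
    then show ?thesis using fX that by (simp add: G.add_closed)
  qed
  show ?thesis
    unfolding G.narrow_def
  proof (intro allI impI, elim conjE)
    fix P assume P: "openin G P" "G.zero \<in> P"
    then have "openin (subtopology X H) (f ` P)"
      using homeomorphic_map_openness_eq[OF homeo] by blast
    then obtain P' where P': "openin X P'" "f ` P = P' \<inter> H" using openin_subtopology by metis
    have "f G.zero \<in> P' \<inter> H" using P(2) unfolding P'(2)[symmetric] by (rule imageI)
    then have "X.zero \<in> P'" by (simp add: zero)
    then obtain V where V: "X.invariant_nbhd V" "\<And>v w. v \<in> V \<Longrightarrow> w \<in> V \<Longrightarrow> addX v w \<in> P'"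
      using X.invariant_nbhd_exists[OF P'(1)] by blast
    have Vinv: "X.gyr_invariant V" "\<And>v. v \<in> V \<Longrightarrow> X.neg v \<in> V"
        and V0: "X.zero \<in> X interior_of V"
      using V(1) by (auto simp: X.invariant_nbhd_def)
    obtain D where D: "countable D" "D \<subseteq> topspace X" "X closure_of D = topspace X"
      using sep by (auto simp: separable_space_def)
    define near where "near d x \<longleftrightarrow> x \<in> topspace G \<and> addX (X.neg (f x)) d \<in> V" for d x
    define c where "c d = (SOME x. near d x)" for d
    define D' where "D' = {d \<in> D. \<exists>x. near d x}"
    have c: "near d (c d)" if "d \<in> D'" for d
      using that unfolding c_def D'_def by (blast intro: someI_ex)
    have "\<exists>e\<in>c ` D'. addG (G.neg e) x \<in> P" if x: "x \<in> topspace G" for x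
    proof -
      define U where "U = {z \<in> topspace X. addX (X.neg (f x)) z \<in> X interior_of V}"
      have "openin X U" unfolding U_def using fX[OF x] by (intro X.openin_diff_preimage) auto
      moreover have "f x \<in> U" using fX[OF x] V0 by (simp add: U_def)
      ultimately have "D \<inter> U \<noteq> {}" using D(3) unfolding dense_intersects_open by blast
      then obtain d where d: "d \<in> D" "addX (X.neg (f x)) d \<in> V" "d \<in> topspace X"
        using interior_of_subset[of X V] unfolding U_def by blast
      then have "near d x" using x by (simp add: near_def)
      then have dD: "d \<in> D'" using d(1) unfolding D'_def by blast
      then have cd: "c d \<in> topspace G" "addX (X.neg (f (c d))) d \<in> V"
        using c by (auto simp: near_def)
      have "addX (X.neg d) (f x) \<in> V"
        using X.diff_mem_sym[OF Vinv fX[OF x] d(3,2)] .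
      then have "addX (X.neg (f (c d))) (f x) \<in> P'"
        using X.diff_mem_trans[OF Vinv(1) V(2) fX[OF cd(1)] d(3) fX[OF x] cd(2)] by blast
      then have "f (addG (G.neg (c d)) x) \<in> P'" using diff cd(1) x by simp
      moreover have dG: "addG (G.neg (c d)) x \<in> topspace G" using cd(1) x by (simp add: G.add_closed)
      ultimately have "f (addG (G.neg (c d)) x) \<in> f ` P" using P'(2) img by blast
      then have "addG (G.neg (c d)) x \<in> P"
        using inj dG openin_subset[OF P(1)] by (meson inj_on_image_mem_iff)
      then show ?thesis using dD by blast
    qed
    moreover have "countable (c ` D')" using D(1) by (simp add: D'_def)
    moreover have "c ` D' \<subseteq> topspace G" using c by (auto simp: near_def)
    ultimately show "\<exists>D. countable D \<and> D \<subseteq> topspace G \<and>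
        (\<forall>x\<in>topspace G. \<exists>d\<in>D. addG (G.neg d) x \<in> P)"
      by blast
  qed
qed

text \<open>\<open>C A\<close> is the interior of the closure of the part of a countable dense set enumerated by
  \<open>A\<close>.\<close>

lemma separable_Hausdorff_nbhd_family:
  assumes "separable_space X" "Hausdorff_space X" "z \<in> topspace X"
  shows "\<exists>C :: nat set \<Rightarrow> 'b set. (\<forall>A. openin X (C A) \<and> z \<in> C A) \<and> (\<Inter>A. C A) = {z}"
proof -
  obtain D where D: "countable D" "D \<subseteq> topspace X" "X closure_of D = topspace X"
    using assms(1) by (auto simp: separable_space_def)
  have "D \<noteq> {}" using D(3) assms(3) by auto
  define cl where "cl A = X closure_of (from_nat_into D ` A)" for A
  \<comment> \<open>The default \<open>topspace X\<close> makes every \<open>C A\<close> a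
    neighbourhood of \<open>z\<close>.\<close>
  define C where "C A = (if z \<in> X interior_of cl A then X interior_of cl A else topspace X)" for A
  have "openin X (C A)" "z \<in> C A" for A using assms(3) by (auto simp: C_def)
  moreover have "y = z" if y: "y \<in> (\<Inter>A. C A)" for y
  proof (rule ccontr)
    assume "y \<noteq> z"
    have "y \<in> topspace X" using y \<open>\<And>A. openin X (C A)\<close> openin_subset by blast
    then obtain U W where UW: "openin X U" "openin X W" "z \<in> U" "y \<in> W" "disjnt U W"
      using assms(2,3) \<open>y \<noteq> z\<close> unfolding Hausdorff_space_def by metis
    \<comment> \<open>\<open>A\<close> selects the points of \<open>D\<close> in \<open>U\<close>.
      By density the closure of \<open>U \<inter> D\<close> contains \<open>U\<close>, hence is a
      neighbourhood of \<open>z\<close>, while \<open>W\<close> keeps \<open>y\<close> out of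
      it.\<close>
    define A where "A = {n. from_nat_into D n \<in> U}"
    have "from_nat_into D ` A = D \<inter> U"
    proof (intro equalityI subsetI)
      fix d assume d: "d \<in> D \<inter> U"
      then obtain n where "from_nat_into D n = d" using from_nat_into_surj[OF D(1)] by blast
      then show "d \<in> from_nat_into D ` A" using d by (auto simp: A_def)
    qed (use from_nat_into[OF \<open>D \<noteq> {}\<close>] in \<open>auto simp: A_def\<close>)
    then have cl: "cl A = X closure_of (U \<inter> D)" by (simp add: cl_def Int_commute)
    have "U \<subseteq> cl A"
      unfolding cl using openin_Int_closure_of_subset[OF UW(1), of D] D(3) openin_subset[OF UW(1)] by auto
    then have "z \<in> X interior_of cl A" using interior_of_maximal[OF _ UW(1)] UW(3) by blast
    then have "y \<in> cl A" using y interior_of_subset[of X "cl A"] by (auto simp: C_def split: if_splits)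
    then obtain d where "d \<in> U \<inter> D" "d \<in> W" using UW(2,4) unfolding cl in_closure_of by blast
    then show False using UW(5) by (auto simp: disjnt_def)
  qed
  ultimately show ?thesis by (intro exI[of _ C]) blast
qed

theorem theorem4p9:
  fixes G :: "'a topology" and addG :: "'a \<Rightarrow> 'a \<Rightarrow> 'a" and gyrG :: "'a \<Rightarrow> 'a \<Rightarrow> 'a \<Rightarrow> 'a"
    and X :: "'b topology" and addX :: "'b \<Rightarrow> 'b \<Rightarrow> 'b" and gyrX :: "'b \<Rightarrow> 'b \<Rightarrow> 'b \<Rightarrow> 'b"
    and H :: "'b set" and f :: "'a \<Rightarrow> 'b"
  assumes "strongly_topological_gyrogroup G addG gyrG"
    and "Hausdorff_space G"
    and "feathered G"
    and "strongly_topological_gyrogroup X addX gyrX"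
    and "Hausdorff_space X"
    and "separable_space X"
    and "subgyrogroup H (topspace X) addX gyrX"
    and "topological_gyrogroup_iso G addG (subtopology X H) addX f"
  shows "separable_space G"
proof -
  interpret G: strongly_topological_gyrogroup G addG gyrG by (rule assms(1))
  have homeo: "homeomorphic_map G (subtopology X H) f"
    using assms(8) by (simp add: topological_gyrogroup_iso_def)
  have H: "H \<subseteq> topspace X" using assms(7) by (simp add: subgyrogroup_def)
  have f: "continuous_map G X f" "inj_on f (topspace G)"
    using homeomorphic_imp_continuous_map[OF homeo] homeomorphic_imp_injective_map[OF homeo]
    by (auto simp: continuous_map_in_subtopology)
  have "f G.zero \<in> topspace X" using f(1) G.zero_closed by (auto simp: continuous_map_def)
  then obtain C :: "nat set \<Rightarrow> 'b set" where C: "\<And>A. openin X (C A)" "\<And>A. f G.zero \<in> C A"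
      "(\<Inter>A. C A) = {f G.zero}"
    using separable_Hausdorff_nbhd_family[OF assms(6,5)] by metis
  show ?thesis
  \<comment> \<open>The chains are built in \<open>G\<close>, which is feathered; \<open>X\<close>
    contributes the narrowness of \<open>G\<close> and the neighbourhoods pulled back along
    \<open>f\<close>.\<close>
  proof (rule G.separable_if_narrow[OF assms(3,2)])
    show "G.narrow"
      using subgyrogroup_of_separable_narrow[OF assms(1,4,6) H assms(8)] .
    let ?C = "\<lambda>A. {x \<in> topspace G. f x \<in> C A}"
    show "openin G (?C A)" for A using f(1) C(1) by (rule openin_continuous_map_preimage)
    show "G.zero \<in> ?C A" for A using C(2) by simp
    show "(\<Inter>A. ?C A) \<subseteq> {G.zero}"
    proof
      fix x assume "x \<in> (\<Inter>A. ?C A)"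
      then have "x \<in> topspace G" "f x \<in> (\<Inter>A. C A)" by auto
      then show "x \<in> {G.zero}" using C(3) f(2) by (simp add: inj_on_def)
    qed
  qed
qed

end
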